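(* Let $(\mathbb{H},X)$ be one of the following pairs: $\mathbb{H}=\mathbb{H}^{Cl}_{W(A_{n-1})}$ and $X=\widetilde{\mathrm{St}}_{A_{n-1}}$; or $\mathbb{H}=\mathbb{H}^{Cl}_{W(B_n)}(\mathbf{k},N_{B_n})$ with $N_{B_n}=2(n-1)\mathbf{k}_\alpha^2+\sqrt2\,\mathbf{k}_\alpha\mathbf{k}_\beta$ ($\alpha$ a long root, $\beta$ a short root of $R(B_n)$) and $X=\widetilde{\mathrm{St}}_{B_n}$; or $\mathbb{H}=\mathbb{H}^{Cl}_{W(D_n)}(\mathbf{k},N_{D_n})$ with $N_{D_n}=2(n-1)\mathbf{k}^2$ and $X=\widetilde{\mathrm{St}}_{D_n}$. Then the Dirac element $D\in\mathbb{H}$ acts identically by zero on $X$. In particular, $H_D(X)=\ker D/(\ker D\cap\mathrm{im}\,D)\neq0$.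
   Context: Everything is over $\mathbb{C}$; $e_1,\dots,e_n$ is the standard basis of $\mathbb{R}^n$ with $\langle e_i,e_j\rangle=\delta_{ij}$. Root systems: $R(A_{n-1})=\{e_i-e_j:i\ne j\}$, $R(B_n)=\{\pm e_i\pm e_j:i<j\}\cup\{\pm e_i\}$, $R(D_n)=\{\pm e_i\pm e_j:i<j\}$, with positive roots $e_i-e_j$ ($i<j$) in type $A_{n-1}$; $e_i\pm e_j$ ($i<j$) and $e_i$ in type $B_n$; $e_i\pm e_j$ ($i<j$) in type $D_n$. $W(\cdot)$ is the Weyl group, $s_\alpha$ the reflection in $\alpha$, and $\mathbf{k}:R\to\mathbb{C}$, $\alpha\mapsto\mathbf{k}_\alpha$, a $W$-invariant function (its single value is written $\mathbf{k}$ in types $A_{n-1},D_n$). Write $s_{i,j}=s_{e_i-e_j}$, $s_n=s_{e_n}$. Type $A_{n-1}$: $\mathbb{H}^{Cl}_{W(A_{n-1})}$ is the unital algebra generated by $x_i,c_i$ ($1\le i\le n$) and $w\in W(A_{n-1})=S_n$ such that $\mathbb{C}[S_n]$ embeds as a subalgebra, with relations: $x_ix_j=x_jx_i$; $x_ic_j=c_jx_i$ ($i\ne j$), $x_ic_i=-c_ix_i$; $c_ic_j=-c_jc_i$ ($i\neq j$), $c_i^2=-1$; $wc_i=c_{w(i)}w$; $s_{i,i+1}x_i-x_{i+1}s_{i,i+1}=\mathbf{k}(-1+c_ic_{i+1})$, and $s_{i,i+1}x_j=x_js_{i,i+1}$ for $j\ne i,i+1$. Type $B_n$: $\mathbb{H}^{Cl}_{W(B_n)}(\mathbf{k},N)$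 ($N\in\mathbb{C}$) is generated by $x_i,c_i$ and $w\in W(B_n)$ with $\mathbb{C}[W(B_n)]$ embedded, subject to all relations of type $A_{n-1}$ above except $x_ix_j=x_jx_i$ (for $w\in S_n\subset W(B_n)$ and $\mathbf{k}$ the value on long roots $\pm e_i\pm e_j$), together with $s_nc_n=-c_ns_n$, $s_nc_i=c_is_n$ ($i\ne n$); $s_nx_n+x_ns_n=-\sqrt2\,\mathbf{k}_{e_n}$, $s_nx_j=x_js_n$ ($j\ne n$); $x_ix_j-x_jx_i=N c_jc_i$ ($i\ne j$). Type $D_n$: let $\mathbf{k}^B$ on $R(B_n)$ equal $\mathbf{k}$ on $R(D_n)$ and $0$ on short roots $\pm e_i$; $\mathbb{H}^{Cl}_{W(D_n)}(\mathbf{k},N)$ is the subalgebra of $\mathbb{H}^{Cl}_{W(B_n)}(\mathbf{k}^B,N)$ generated by $W(D_n)$, the $x_i$ and the $c_i$. For positive roots: $c_{e_i\pm e_j}=\frac{\sqrt2}{2}(c_i\pm c_j)$ ($i<j$), $c_{e_i}=c_i$, $\widetilde s_\alpha=s_\alpha c_\alpha$. The Dirac element is $D=\sum_{i=1}^nx_ic_i+\frac{\sqrt2}{2}\sum_{\alpha>0}\mathbf{k}_\alpha\langle\alpha,\alpha\rangle\widetilde s_\alpha$. $\mathrm{Cl}_n$ is the subalgebra generated by the $c_i$ (a Clifford algebra). $\widetilde{\mathrm{St}}_{A_{n-1}}$: the $\mathbb{H}^{Cl}_{W(A_{n-1})}$-supermodule with underlying space $\mathrm{Cl}_n$; $c_i$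 acts by left multiplication, $w\in S_n$ acts by $w.(c_{i_1}\cdots c_{i_r})=c_{w(i_1)}\cdots c_{w(i_r)}$ (so $w.1=1$), and $x_i.v=\mathbf{k}\sum_{1\le j<i}s_{i,j}(1-c_ic_j).v$. $\widetilde{\mathrm{St}}_{B_n}$: let $U(n)$ be an irreducible $\mathrm{Cl}_n$-supermodule. The module is $U(n)\otimes U(n)$ with, for $u$ homogeneous, $x_i.(u\otimes v)=-(-1)^{\deg u}\sqrt{-1}\left(\left(\mathbf{k}_\alpha(c_1+\dots+c_{i-1}+(n-i)c_i)+\frac{\sqrt2}{2}\mathbf{k}_\beta c_i\right).u\right)\otimes(c_i.v)$, $s_n.(u\otimes v)=(-1)^{\deg u}\sqrt{-1}\,(c_n.u)\otimes(c_n.v)$, $s_{i,j}.(u\otimes v)=(-1)^{\deg u}\sqrt{-1}\left(\frac{c_i-c_j}{\sqrt2}.u\right)\otimes\left(\frac{c_i-c_j}{\sqrt2}.v\right)$, $c_i.(u\otimes v)=(-1)^{\deg u}u\otimes(c_i.v)$. For $N_{B_n}$ as in the claim this is an $\mathbb{H}^{Cl}_{W(B_n)}(\mathbf{k},N_{B_n})$-module. $\widetilde{\mathrm{St}}_{D_n}$: the restriction to $\mathbb{H}^{Cl}_{W(D_n)}(\mathbf{k},N_{D_n})$ of the module $\widetilde{\mathrm{St}}_{B_n}$ of $\mathbb{H}^{Cl}_{W(B_n)}(\mathbf{k}^B,N_{D_n})$ (so $\mathbf{k}_\beta=0$). *)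

theory Defs
  imports Complex_Main "HOL-Algebra.Algebra" "HOL-Library.Poly_Mapping"
    "HOL-Library.Function_Algebras"
begin

section \<open>Complex vector spaces and algebras with explicit carriers\<close>

text \<open>
  Complex vector spaces and (noncommutative) complex algebras are both records of type
  \<open>(complex, 'a) module\<close>; for mere vector spaces the fields \<open>mult\<close> and \<open>one\<close> are meaningless.
\<close>

definition complex_ring :: "complex ring" where
  "complex_ring = \<lparr>carrier = UNIV, monoid.mult = (*), monoid.one = 1, ring.zero = 0, ring.add = (+)\<rparr>"

text \<open>
  In the scalar multiplication, adding \<open>S\<close> makes \<open>0 \<odot> K\<close> the coset \<open>S\<close> rather than \<open>{0}\<close>.
\<close>

definition quot_module :: "(complex, 'a) module \<Rightarrow> 'a set \<Rightarrow> (complex, 'a set) module" where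
  "quot_module V S =
    \<lparr>carrier = carrier (V Quot S), monoid.mult = monoid.mult (V Quot S),
     monoid.one = monoid.one (V Quot S),
     ring.zero = ring.zero (V Quot S), ring.add = ring.add (V Quot S),
     smult = (\<lambda>a K. ((\<lambda>v. a \<odot>\<^bsub>V\<^esub> v) ` K) <+>\<^bsub>V\<^esub> S)\<rparr>"

definition lin_span :: "(complex, 'a) module \<Rightarrow> 'a set \<Rightarrow> 'a set" where
  "lin_span V S = \<Inter> {M. submodule M complex_ring V \<and> S \<subseteq> M}"

definition subalgebra_gen :: "(complex, 'a) module \<Rightarrow> 'a set \<Rightarrow> (complex, 'a) module" where
  "subalgebra_gen H S = H\<lparr>carrier :=
     \<Inter> {T. T \<subseteq> carrier H \<and> S \<subseteq> T \<and> submodule T complex_ring H \<and>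
           \<one>\<^bsub>H\<^esub> \<in> T \<and> (\<forall>a\<in>T. \<forall>b\<in>T. a \<otimes>\<^bsub>H\<^esub> b \<in> T)}\<rparr>"

locale algebra_module = V: Module.module complex_ring V
  for H :: "(complex, 'h) module" and V :: "(complex, 'v) module" and act :: "'h \<Rightarrow> 'v \<Rightarrow> 'v" +
  assumes act_closed: "\<lbrakk>h \<in> carrier H; v \<in> carrier V\<rbrakk> \<Longrightarrow> act h v \<in> carrier V"
    and act_add_right: "\<lbrakk>h \<in> carrier H; v \<in> carrier V; v' \<in> carrier V\<rbrakk>
      \<Longrightarrow> act h (v \<oplus>\<^bsub>V\<^esub> v') = act h v \<oplus>\<^bsub>V\<^esub> act h v'"
    and act_smult_right: "\<lbrakk>h \<in> carrier H; v \<in> carrier V\<rbrakk>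
      \<Longrightarrow> act h (a \<odot>\<^bsub>V\<^esub> v) = a \<odot>\<^bsub>V\<^esub> act h v"
    and act_add_left: "\<lbrakk>h \<in> carrier H; h' \<in> carrier H; v \<in> carrier V\<rbrakk>
      \<Longrightarrow> act (h \<oplus>\<^bsub>H\<^esub> h') v = act h v \<oplus>\<^bsub>V\<^esub> act h' v"
    and act_smult_left: "\<lbrakk>h \<in> carrier H; v \<in> carrier V\<rbrakk>
      \<Longrightarrow> act (a \<odot>\<^bsub>H\<^esub> h) v = a \<odot>\<^bsub>V\<^esub> act h v"
    and act_mult: "\<lbrakk>h \<in> carrier H; h' \<in> carrier H; v \<in> carrier V\<rbrakk>
      \<Longrightarrow> act (h \<otimes>\<^bsub>H\<^esub> h') v = act h (act h' v)"
    and act_one: "v \<in> carrier V \<Longrightarrow> act \<one>\<^bsub>H\<^esub> v = v"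


section \<open>Algebras given by generators and relations\<close>

datatype 'g word = Word (letters: "'g list")

instantiation word :: (type) monoid_add
begin

definition zero_word :: "'a word" where "zero_word = Word []"

definition plus_word :: "'a word \<Rightarrow> 'a word \<Rightarrow> 'a word" where
  "plus_word u v = Word (letters u @ letters v)"

instance
  by standard (simp_all add: zero_word_def plus_word_def)

end

text \<open>
  The monoid algebra of the free monoid: the type \<open>'g word \<Rightarrow>\<^sub>0 complex\<close> of finitely supported
  functions, with the convolution product of \<^theory>\<open>HOL-Library.Poly_Mapping\<close>, is the free
  unital associative algebra on \<open>'g\<close>.
\<close>

type_synonym 'g free = "'g word \<Rightarrow>\<^sub>0 complex"

definition gen_of :: "'g \<Rightarrow> 'g free" where
  "gen_of g = Poly_Mapping.single (Word [g]) 1"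

definition scal :: "complex \<Rightarrow> 'g free" where
  "scal a = Poly_Mapping.single 0 a"

definition free_algebra :: "'g set \<Rightarrow> (complex, 'g free) module" where
  "free_algebra A =
    \<lparr>carrier = {p. \<forall>w\<in>Poly_Mapping.keys p. set (letters w) \<subseteq> A},
     monoid.mult = (*), monoid.one = 1, ring.zero = 0, ring.add = (+), smult = (\<lambda>a p. scal a * p)\<rparr>"

definition presented_algebra :: "'g set \<Rightarrow> 'g free set \<Rightarrow> (complex, 'g free set) module" where
  "presented_algebra A R = quot_module (free_algebra A) (genideal (free_algebra A) R)"

text \<open>The image in the presented algebra of a noncommutative polynomial in the generators.\<close>

definition pres_class :: "'g set \<Rightarrow> 'g free set \<Rightarrow> 'g free \<Rightarrow> 'g free set" where
  "pres_class A R p = genideal (free_algebra A) R +>\<^bsub>free_algebra A\<^esub> p"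


section \<open>Tensor products of complex vector spaces\<close>

definition free_space :: "'b set \<Rightarrow> (complex, 'b \<Rightarrow>\<^sub>0 complex) module" where
  "free_space B =
    \<lparr>carrier = {f. Poly_Mapping.keys f \<subseteq> B}, monoid.mult = undefined, monoid.one = undefined,
     ring.zero = 0, ring.add = (+), smult = (\<lambda>a. Poly_Mapping.map ((*) a))\<rparr>"

definition tensor_rels ::
  "(complex, 'u) module \<Rightarrow> (complex, 'v) module \<Rightarrow> (('u \<times> 'v) \<Rightarrow>\<^sub>0 complex) set" where
  "tensor_rels U V = (let t = (\<lambda>u v. Poly_Mapping.single (u, v) (1::complex)) in
     {t (u \<oplus>\<^bsub>U\<^esub> u') v - t u v - t u' v | u u' v. u \<in> carrier U \<and> u' \<in> carrier U \<and> v \<in> carrier V}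
   \<union> {t u (v \<oplus>\<^bsub>V\<^esub> v') - t u v - t u v' | u v v'. u \<in> carrier U \<and> v \<in> carrier V \<and> v' \<in> carrier V}
   \<union> {t (a \<odot>\<^bsub>U\<^esub> u) v - Poly_Mapping.single (u, v) a | a u v. u \<in> carrier U \<and> v \<in> carrier V}
   \<union> {t u (a \<odot>\<^bsub>V\<^esub> v) - Poly_Mapping.single (u, v) a | a u v. u \<in> carrier U \<and> v \<in> carrier V})"

definition tensor_ker ::
  "(complex, 'u) module \<Rightarrow> (complex, 'v) module \<Rightarrow> (('u \<times> 'v) \<Rightarrow>\<^sub>0 complex) set" where
  "tensor_ker U V = lin_span (free_space (carrier U \<times> carrier V)) (tensor_rels U V)"

definition tensor ::
  "(complex, 'u) module \<Rightarrow> (complex, 'v) module \<Rightarrow> (complex, (('u \<times> 'v) \<Rightarrow>\<^sub>0 complex) set) module"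
  where
  "tensor U V = quot_module (free_space (carrier U \<times> carrier V)) (tensor_ker U V)"

definition pure_tensor ::
  "(complex, 'u) module \<Rightarrow> (complex, 'v) module \<Rightarrow> 'u \<Rightarrow> 'v \<Rightarrow> (('u \<times> 'v) \<Rightarrow>\<^sub>0 complex) set" where
  "pure_tensor U V u v =
     tensor_ker U V +>\<^bsub>free_space (carrier U \<times> carrier V)\<^esub> Poly_Mapping.single (u, v) 1"


section \<open>Root systems and Weyl groups\<close>

text \<open>
  Vectors of \<open>\<real>\<^sup>n\<close> are functions on \<open>nat\<close>, of which only the coordinates \<open>1, \<dots>, n\<close> matter; the
  reflections below leave all other coordinates unchanged.
\<close>

type_synonym vec = "nat \<Rightarrow> real"

definition std_basis :: "nat \<Rightarrow> vec" where
  "std_basis i = (\<lambda>j. if j = i then 1 else 0)"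

definition ip :: "nat \<Rightarrow> vec \<Rightarrow> vec \<Rightarrow> real" where
  "ip n v w = (\<Sum>i=1..n. v i * w i)"

definition reflection :: "nat \<Rightarrow> vec \<Rightarrow> vec \<Rightarrow> vec" where
  "reflection n \<alpha> v = (\<lambda>j. v j - 2 * ip n v \<alpha> / ip n \<alpha> \<alpha> * \<alpha> j)"

definition pos_roots_A :: "nat \<Rightarrow> vec set" where
  "pos_roots_A n = {std_basis i - std_basis j | i j. 1 \<le> i \<and> i < j \<and> j \<le> n}"

definition pos_roots_D :: "nat \<Rightarrow> vec set" where
  "pos_roots_D n = {std_basis i - std_basis j | i j. 1 \<le> i \<and> i < j \<and> j \<le> n}
     \<union> {std_basis i + std_basis j | i j. 1 \<le> i \<and> i < j \<and> j \<le> n}"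

definition pos_roots_B :: "nat \<Rightarrow> vec set" where
  "pos_roots_B n = pos_roots_D n \<union> {std_basis i | i. 1 \<le> i \<and> i \<le> n}"

definition roots_A :: "nat \<Rightarrow> vec set" where
  "roots_A n = pos_roots_A n \<union> uminus ` pos_roots_A n"

definition roots_B :: "nat \<Rightarrow> vec set" where
  "roots_B n = pos_roots_B n \<union> uminus ` pos_roots_B n"

definition roots_D :: "nat \<Rightarrow> vec set" where
  "roots_D n = pos_roots_D n \<union> uminus ` pos_roots_D n"

definition long_roots_B :: "nat \<Rightarrow> vec set" where
  "long_roots_B n = {\<alpha> \<in> roots_B n. ip n \<alpha> \<alpha> = 2}"

definition short_roots_B :: "nat \<Rightarrow> vec set" where
  "short_roots_B n = {\<alpha> \<in> roots_B n. ip n \<alpha> \<alpha> = 1}"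

inductive_set weyl :: "nat \<Rightarrow> vec set \<Rightarrow> (vec \<Rightarrow> vec) set" for n :: nat and R :: "vec set" where
  weyl_id: "id \<in> weyl n R"
| weyl_refl: "\<lbrakk>\<alpha> \<in> R; w \<in> weyl n R\<rbrakk> \<Longrightarrow> reflection n \<alpha> \<circ> w \<in> weyl n R"

definition weyl_invariant :: "nat \<Rightarrow> vec set \<Rightarrow> (vec \<Rightarrow> complex) \<Rightarrow> bool" where
  "weyl_invariant n R k \<longleftrightarrow> (\<forall>w\<in>weyl n R. \<forall>\<alpha>\<in>R. k (w \<alpha>) = k \<alpha>)"

text \<open>
  The index \<open>w(i)\<close>, for \<open>w\<close> in the Weyl group of type \<open>A\<^bsub>n-1\<^esub>\<close> regarded as the symmetric group:
  \<open>w e\<^sub>i = e\<^bsub>w(i)\<^esub>\<close>.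
\<close>

definition perm_index :: "(vec \<Rightarrow> vec) \<Rightarrow> nat \<Rightarrow> nat" where
  "perm_index w i = (THE j. w (std_basis i) = std_basis j)"


section \<open>The algebras\<close>

datatype generator = Xgen nat | Cgen nat | Wgen "vec \<Rightarrow> vec"

abbreviation xx :: "nat \<Rightarrow> generator free" where "xx i \<equiv> gen_of (Xgen i)"
abbreviation cc :: "nat \<Rightarrow> generator free" where "cc i \<equiv> gen_of (Cgen i)"
abbreviation ww :: "(vec \<Rightarrow> vec) \<Rightarrow> generator free" where "ww w \<equiv> gen_of (Wgen w)"

abbreviation refl_ij :: "nat \<Rightarrow> nat \<Rightarrow> nat \<Rightarrow> vec \<Rightarrow> vec" where
  "refl_ij n i j \<equiv> reflection n (std_basis i - std_basis j)"

abbreviation sqrt2 :: complex where "sqrt2 \<equiv> complex_of_real (sqrt 2)"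

text \<open>An element \<open>p\<close> of a set of relations stands for the relation \<open>p = 0\<close>.\<close>

definition clifford_rels :: "nat \<Rightarrow> generator free set" where
  "clifford_rels n =
     {cc i * cc j + cc j * cc i | i j. i \<in> {1..n} \<and> j \<in> {1..n} \<and> i \<noteq> j}
   \<union> {cc i * cc i + 1 | i. i \<in> {1..n}}"

definition group_rels :: "(vec \<Rightarrow> vec) set \<Rightarrow> generator free set" where
  "group_rels W = {ww w * ww w' - ww (w \<circ> w') | w w'. w \<in> W \<and> w' \<in> W} \<union> {ww id - 1}"

text \<open>
  The relations of type \<open>A\<^bsub>n-1\<^esub>\<close> apart from \<open>x\<^sub>i x\<^sub>j = x\<^sub>j x\<^sub>i\<close>, for an ambient group \<open>W\<close> containing
  the symmetric group.
\<close>

definition common_rels ::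
  "nat \<Rightarrow> (vec \<Rightarrow> vec) set \<Rightarrow> (vec \<Rightarrow> complex) \<Rightarrow> generator free set" where
  "common_rels n W k = group_rels W \<union> clifford_rels n
   \<union> {xx i * cc j - cc j * xx i | i j. i \<in> {1..n} \<and> j \<in> {1..n} \<and> i \<noteq> j}
   \<union> {xx i * cc i + cc i * xx i | i. i \<in> {1..n}}
   \<union> {ww w * cc i - cc (perm_index w i) * ww w | w i. w \<in> weyl n (roots_A n) \<and> i \<in> {1..n}}
   \<union> {ww (refl_ij n i (i+1)) * xx i - xx (i+1) * ww (refl_ij n i (i+1))
        - scal (k (std_basis i - std_basis (i+1))) * (- 1 + cc i * cc (i+1)) | i. 1 \<le> i \<and> i < n}
   \<union> {ww (refl_ij n i (i+1)) * xx j - xx j * ww (refl_ij n i (i+1)) | i j.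
        1 \<le> i \<and> i < n \<and> j \<in> {1..n} \<and> j \<noteq> i \<and> j \<noteq> i+1}"

definition rels_A :: "nat \<Rightarrow> complex \<Rightarrow> generator free set" where
  "rels_A n k = common_rels n (weyl n (roots_A n)) (\<lambda>_. k)
   \<union> {xx i * xx j - xx j * xx i | i j. i \<in> {1..n} \<and> j \<in> {1..n}}"

definition rels_B :: "nat \<Rightarrow> (vec \<Rightarrow> complex) \<Rightarrow> complex \<Rightarrow> generator free set" where
  "rels_B n k N = (let s = ww (reflection n (std_basis n)) in
     common_rels n (weyl n (roots_B n)) k
   \<union> {s * cc n + cc n * s}
   \<union> {s * cc i - cc i * s | i. i \<in> {1..n} \<and> i \<noteq> n}
   \<union> {s * xx n + xx n * s + scal (sqrt2 * k (std_basis n))}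
   \<union> {s * xx j - xx j * s | j. j \<in> {1..n} \<and> j \<noteq> n}
   \<union> {xx i * xx j - xx j * xx i - scal N * (cc j * cc i) | i j.
        i \<in> {1..n} \<and> j \<in> {1..n} \<and> i \<noteq> j})"

definition gens :: "nat \<Rightarrow> (vec \<Rightarrow> vec) set \<Rightarrow> generator set" where
  "gens n W = Xgen ` {1..n} \<union> Cgen ` {1..n} \<union> Wgen ` W"

definition H_A :: "nat \<Rightarrow> complex \<Rightarrow> (complex, generator free set) module" where
  "H_A n k = presented_algebra (gens n (weyl n (roots_A n))) (rels_A n k)"

definition elt_A :: "nat \<Rightarrow> complex \<Rightarrow> generator free \<Rightarrow> generator free set" where
  "elt_A n k = pres_class (gens n (weyl n (roots_A n))) (rels_A n k)"

definition H_B ::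
  "nat \<Rightarrow> (vec \<Rightarrow> complex) \<Rightarrow> complex \<Rightarrow> (complex, generator free set) module" where
  "H_B n k N = presented_algebra (gens n (weyl n (roots_B n))) (rels_B n k N)"

definition elt_B ::
  "nat \<Rightarrow> (vec \<Rightarrow> complex) \<Rightarrow> complex \<Rightarrow> generator free \<Rightarrow> generator free set" where
  "elt_B n k N = pres_class (gens n (weyl n (roots_B n))) (rels_B n k N)"

definition k_ext :: "nat \<Rightarrow> complex \<Rightarrow> vec \<Rightarrow> complex" where
  "k_ext n k \<alpha> = (if \<alpha> \<in> roots_D n then k else 0)"

definition H_D :: "nat \<Rightarrow> complex \<Rightarrow> complex \<Rightarrow> (complex, generator free set) module" where
  "H_D n k N = subalgebra_gen (H_B n (k_ext n k) N)
     ((\<lambda>g. elt_B n (k_ext n k) N (gen_of g)) ` gens n (weyl n (roots_D n)))"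

definition clifford :: "nat \<Rightarrow> (complex, generator free set) module" where
  "clifford n = presented_algebra (Cgen ` {1..n}) (clifford_rels n)"

definition elt_Cl :: "nat \<Rightarrow> generator free \<Rightarrow> generator free set" where
  "elt_Cl n = pres_class (Cgen ` {1..n}) (clifford_rels n)"


section \<open>The Dirac element and Dirac cohomology\<close>

text \<open>
  The Clifford element of a root is that of the corresponding unit vector; the lemmas below
  spell this out for the three kinds of positive roots.
\<close>

definition c_root :: "nat \<Rightarrow> vec \<Rightarrow> generator free" where
  "c_root n \<alpha> = (\<Sum>i=1..n. scal (complex_of_real (\<alpha> i / sqrt (ip n \<alpha> \<alpha>))) * cc i)"

lemma c_root_sum:
  assumes "finite A" "A \<subseteq> {1..n}" "\<And>i. i \<in> {1..n} \<Longrightarrow> i \<notin> A \<Longrightarrow> \<alpha> i = 0"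
  shows "c_root n \<alpha> = (\<Sum>i\<in>A. scal (complex_of_real (\<alpha> i / sqrt (\<Sum>l\<in>A. \<alpha> l * \<alpha> l))) * cc i)"
proof -
  have "ip n \<alpha> \<alpha> = (\<Sum>l\<in>A. \<alpha> l * \<alpha> l)"
    unfolding ip_def using assms by (intro sum.mono_neutral_right) auto
  then show ?thesis
    unfolding c_root_def using assms by (simp only:, intro sum.mono_neutral_right) (auto simp: scal_def)
qed

lemma scal_inv_sqrt2: "scal (1 / sqrt2) = scal (sqrt2 / 2)"
proof -
  have "sqrt2 * sqrt2 = 2"
    by (simp flip: of_real_mult)
  then have "1 / sqrt2 = sqrt2 / 2"
    by (auto simp: divide_simps)
  then show ?thesis
    by (rule arg_cong)
qed

lemma c_root_short:
  assumes "i \<in> {1..n}"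
  shows "c_root n (std_basis i) = cc i"
  using assms by (subst c_root_sum[where A = "{i}"]) (auto simp: std_basis_def scal_def)

lemma c_root_plus:
  assumes "i \<in> {1..n}" "j \<in> {1..n}" "i \<noteq> j"
  shows "c_root n (std_basis i + std_basis j) = scal (sqrt2 / 2) * (cc i + cc j)"
  using assms
  by (subst c_root_sum[where A = "{i, j}"])
    (auto simp: std_basis_def distrib_left scal_inv_sqrt2)

lemma c_root_minus:
  assumes "i \<in> {1..n}" "j \<in> {1..n}" "i \<noteq> j"
  shows "c_root n (std_basis i - std_basis j) = scal (sqrt2 / 2) * (cc i - cc j)"
proof -
  have "scal (- a) * p = - (scal a * p)" for a and p :: "generator free"
    by (simp add: scal_def single_uminus)
  then show ?thesis
    using assms
    by (subst c_root_sum[where A = "{i, j}"])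
      (auto simp: std_basis_def right_diff_distrib scal_inv_sqrt2)
qed

definition dirac :: "nat \<Rightarrow> vec set \<Rightarrow> (vec \<Rightarrow> complex) \<Rightarrow> generator free" where
  "dirac n P k = (\<Sum>i=1..n. xx i * cc i)
     + scal (sqrt2 / 2) *
       (\<Sum>\<alpha>\<in>P. scal (k \<alpha> * complex_of_real (ip n \<alpha> \<alpha>)) * (ww (reflection n \<alpha>) * c_root n \<alpha>))"

definition dirac_ker :: "(complex, 'v) module \<Rightarrow> ('v \<Rightarrow> 'v) \<Rightarrow> 'v set" where
  "dirac_ker V T = {v. v \<in> carrier V \<and> T v = \<zero>\<^bsub>V\<^esub>}"

definition dirac_cohomology :: "(complex, 'v) module \<Rightarrow> ('v \<Rightarrow> 'v) \<Rightarrow> (complex, 'v set) module" where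
  "dirac_cohomology V T =
     quot_module (V\<lparr>carrier := dirac_ker V T\<rparr>) (dirac_ker V T \<inter> T ` carrier V)"


section \<open>The modules\<close>

locale steinberg_A = algebra_module "H_A n k" "clifford n" act
  for n :: nat and k :: complex
    and act :: "generator free set \<Rightarrow> generator free set \<Rightarrow> generator free set" +
  assumes act_c: "\<And>i v. \<lbrakk>i \<in> {1..n}; v \<in> carrier (clifford n)\<rbrakk>
      \<Longrightarrow> act (elt_A n k (cc i)) v = elt_Cl n (cc i) \<otimes>\<^bsub>clifford n\<^esub> v"
    and act_w: "\<And>w is. \<lbrakk>w \<in> weyl n (roots_A n); set is \<subseteq> {1..n}\<rbrakk>
      \<Longrightarrow> act (elt_A n k (ww w)) (elt_Cl n (\<Prod>i\<leftarrow>is. cc i))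
          = elt_Cl n (\<Prod>i\<leftarrow>is. cc (perm_index w i))"
    and act_x: "\<And>i v. \<lbrakk>i \<in> {1..n}; v \<in> carrier (clifford n)\<rbrakk>
      \<Longrightarrow> act (elt_A n k (xx i)) v =
          act (elt_A n k (scal k * (\<Sum>j\<in>{1..<i}. ww (refl_ij n i j) * (1 - cc i * cc j)))) v"

text \<open>
  A Clifford supermodule structure on \<open>U\<close>, graded by \<open>U\<^sub>0 = gr 0\<close> and \<open>U\<^sub>1 = gr 1\<close>. The Clifford
  algebra is graded with generators of degree \<open>1\<close>, so compatibility of the gradings only has to
  be required for the generators.
\<close>

locale clifford_supermodule = algebra_module "clifford n" U actU
  for n :: nat and U :: "(complex, 'u) module" and gr :: "nat \<Rightarrow> 'u set"
    and actU :: "generator free set \<Rightarrow> 'u \<Rightarrow> 'u" +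
  assumes gr_submodule: "\<And>d. d \<in> {0, 1} \<Longrightarrow> submodule (gr d) complex_ring U"
    and gr_direct: "gr 0 \<inter> gr 1 = {\<zero>\<^bsub>U\<^esub>}"
    and gr_sum: "carrier U = gr 0 <+>\<^bsub>U\<^esub> gr 1"
    and gr_odd: "\<And>d i u. \<lbrakk>d \<in> {0, 1}; i \<in> {1..n}; u \<in> gr d\<rbrakk>
      \<Longrightarrow> actU (elt_Cl n (cc i)) u \<in> gr (1 - d)"

locale irreducible_clifford_supermodule = clifford_supermodule +
  assumes nonzero: "carrier U \<noteq> {\<zero>\<^bsub>U\<^esub>}"
    and irreducible: "\<And>M. \<lbrakk>submodule M complex_ring U;
        \<And>a u. \<lbrakk>a \<in> carrier (clifford n); u \<in> M\<rbrakk> \<Longrightarrow> actU a u \<in> M;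
        M = (M \<inter> gr 0) <+>\<^bsub>U\<^esub> (M \<inter> gr 1)\<rbrakk> \<Longrightarrow> M = {\<zero>\<^bsub>U\<^esub>} \<or> M = carrier U"

text \<open>
  The parameters \<open>ka\<close> and \<open>kb\<close> are the values of \<open>k\<close> on the long and on the short roots.
\<close>

locale steinberg_B =
  irreducible_clifford_supermodule n U gr actU + T: algebra_module "H_B n k N" "tensor U U" act
  for n :: nat and k :: "vec \<Rightarrow> complex" and ka kb N :: complex
    and U :: "(complex, 'u) module" and gr :: "nat \<Rightarrow> 'u set"
    and actU :: "generator free set \<Rightarrow> 'u \<Rightarrow> 'u"
    and act :: "generator free set \<Rightarrow> (('u \<times> 'u) \<Rightarrow>\<^sub>0 complex) set
                  \<Rightarrow> (('u \<times> 'u) \<Rightarrow>\<^sub>0 complex) set" +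
  assumes act_x: "\<And>i d u v. \<lbrakk>i \<in> {1..n}; d \<in> {0, 1}; u \<in> gr d; v \<in> carrier U\<rbrakk>
      \<Longrightarrow> act (elt_B n k N (xx i)) (pure_tensor U U u v) =
        (- ((- 1) ^ d * \<i>)) \<odot>\<^bsub>tensor U U\<^esub>
        pure_tensor U U
          (actU (elt_Cl n (scal ka * ((\<Sum>j\<in>{1..<i}. cc j) + scal (of_nat (n - i)) * cc i)
                           + scal (sqrt2 / 2 * kb) * cc i)) u)
          (actU (elt_Cl n (cc i)) v)"
    and act_sn: "\<And>d u v. \<lbrakk>d \<in> {0, 1}; u \<in> gr d; v \<in> carrier U\<rbrakk>
      \<Longrightarrow> act (elt_B n k N (ww (reflection n (std_basis n)))) (pure_tensor U U u v) =
        ((- 1) ^ d * \<i>) \<odot>\<^bsub>tensor U U\<^esub>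
        pure_tensor U U (actU (elt_Cl n (cc n)) u) (actU (elt_Cl n (cc n)) v)"
    and act_sij: "\<And>i j d u v.
        \<lbrakk>i \<in> {1..n}; j \<in> {1..n}; i \<noteq> j; d \<in> {0, 1}; u \<in> gr d; v \<in> carrier U\<rbrakk>
      \<Longrightarrow> act (elt_B n k N (ww (refl_ij n i j))) (pure_tensor U U u v) =
        ((- 1) ^ d * \<i>) \<odot>\<^bsub>tensor U U\<^esub>
        pure_tensor U U
          (actU (elt_Cl n (scal (1 / sqrt2) * (cc i - cc j))) u)
          (actU (elt_Cl n (scal (1 / sqrt2) * (cc i - cc j))) v)"
    and act_c: "\<And>i d u v. \<lbrakk>i \<in> {1..n}; d \<in> {0, 1}; u \<in> gr d; v \<in> carrier U\<rbrakk>
      \<Longrightarrow> act (elt_B n k N (cc i)) (pure_tensor U U u v) =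
        ((- 1) ^ d) \<odot>\<^bsub>tensor U U\<^esub> pure_tensor U U u (actU (elt_Cl n (cc i)) v)"

text \<open>
  Type \<open>D\<^sub>n\<close>: the restriction of a type \<open>B\<^sub>n\<close> module to the subalgebra, with action \<open>actD\<close>.
\<close>

definition steinberg_D where
  "steinberg_D n k N U gr actU actD \<longleftrightarrow>
     (\<exists>act. steinberg_B n (k_ext n k) k 0 N U gr actU act \<and>
            actD = restrict act (carrier (H_D n k N)))"

end

theory Submission
  imports Defs
begin

text \<open>
  In type \<open>A\<close> the element \<open>x\<^sub>i c\<^sub>i\<close> acts as \<open>k \<Sum>\<^bsub>j<i\<^esub> s\<^bsub>i,j\<^esub> (1 - c\<^sub>i c\<^sub>j) c\<^sub>i = k \<Sum>\<^bsub>j<i\<^esub> s\<^bsub>i,j\<^esub> (c\<^sub>i - c\<^sub>j)\<close>,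
  which is cancelled by the terms \<open>k s\<^bsub>j,i\<^esub> (c\<^sub>j - c\<^sub>i)\<close> of the Dirac element. In type \<open>B\<close> every positive
  root satisfies \<open>s\<^sub>\<alpha> (u \<otimes> v) = (-1)\<^sup>d \<i> c\<^sub>\<alpha> u \<otimes> c\<^sub>\<alpha> v\<close> for \<open>u\<close> of degree \<open>d\<close>: this is given for \<open>e\<^sub>n\<close> and
  \<open>e\<^sub>i - e\<^sub>j\<close>, and passes to the other roots by conjugation, as \<open>c\<^sub>\<beta> c\<^sub>\<alpha> c\<^sub>\<beta>\<close> is the Clifford element of the
  reflected root. Since \<open>c\<^sub>\<alpha>\<^sup>2 = -1\<close>, the element \<open>s\<^sub>\<alpha> c\<^sub>\<alpha>\<close> then acts as \<open>-\<i> c\<^sub>\<alpha>\<close> on the left factor alone,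
  and \<open>x\<^sub>i c\<^sub>i\<close> also acts on the left factor only; the resulting linear combination of the \<open>c\<^sub>i\<close> vanishes
  identically. Type \<open>D\<close> is the case of vanishing short parameter. The cohomology is then the whole
  module, which is nonzero because the Clifford algebra has its standard representation on the
  exterior algebra and because a product of two linear functionals detects a pure tensor.
\<close>

section \<open>Complex vector spaces and their quotients\<close>

lemma complex_ring_simps [simp]:
  "carrier complex_ring = UNIV" "\<one>\<^bsub>complex_ring\<^esub> = 1" "\<zero>\<^bsub>complex_ring\<^esub> = 0"
  "a \<otimes>\<^bsub>complex_ring\<^esub> b = a * b" "a \<oplus>\<^bsub>complex_ring\<^esub> b = a + b"
  by (simp_all add: complex_ring_def)

lemma cring_complex_ring: "cring complex_ring"
proof (rule cringI)
  show "abelian_group complex_ring"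
    by (rule abelian_groupI) (auto simp: algebra_simps intro: exI[of _ "- x" for x])
  show "Group.comm_monoid complex_ring"
    by (rule comm_monoidI) (auto simp: algebra_simps)
qed (auto simp: algebra_simps)

lemma module_complexI:
  assumes "abelian_group V"
    and "\<And>a v. v \<in> carrier V \<Longrightarrow> a \<odot>\<^bsub>V\<^esub> v \<in> carrier V"
    and "\<And>a b v. v \<in> carrier V \<Longrightarrow> (a + b) \<odot>\<^bsub>V\<^esub> v = a \<odot>\<^bsub>V\<^esub> v \<oplus>\<^bsub>V\<^esub> b \<odot>\<^bsub>V\<^esub> v"
    and "\<And>a v w. \<lbrakk>v \<in> carrier V; w \<in> carrier V\<rbrakk>
      \<Longrightarrow> a \<odot>\<^bsub>V\<^esub> (v \<oplus>\<^bsub>V\<^esub> w) = a \<odot>\<^bsub>V\<^esub> v \<oplus>\<^bsub>V\<^esub> a \<odot>\<^bsub>V\<^esub> w"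
    and "\<And>a b v. v \<in> carrier V \<Longrightarrow> (a * b) \<odot>\<^bsub>V\<^esub> v = a \<odot>\<^bsub>V\<^esub> (b \<odot>\<^bsub>V\<^esub> v)"
    and "\<And>v. v \<in> carrier V \<Longrightarrow> 1 \<odot>\<^bsub>V\<^esub> v = v"
  shows "Module.module complex_ring V"
  using assms by (intro moduleI cring_complex_ring) auto

text \<open>Fixing the scalars to the complex numbers discharges every scalar side condition of
  \<open>Module.module\<close>; the module laws are restated in that form.\<close>

locale complex_space = Module.module complex_ring V for V :: "(complex, 'v) module" (structure)
begin

lemma smult_mem [simp, intro]: "v \<in> carrier V \<Longrightarrow> a \<odot> v \<in> carrier V"
  using smult_closed by simp

lemma smult_smult: "v \<in> carrier V \<Longrightarrow> a \<odot> (b \<odot> v) = (a * b) \<odot> v"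
  using smult_assoc1[of a b v] by simp

lemma add_smult: "v \<in> carrier V \<Longrightarrow> (a + b) \<odot> v = a \<odot> v \<oplus> b \<odot> v"
  using smult_l_distr[of a b v] by simp

lemma smult_add: "\<lbrakk>v \<in> carrier V; w \<in> carrier V\<rbrakk> \<Longrightarrow> a \<odot> (v \<oplus> w) = a \<odot> v \<oplus> a \<odot> w"
  using smult_r_distr[of a v w] by simp

lemma one_smult [simp]: "v \<in> carrier V \<Longrightarrow> 1 \<odot> v = v"
  using smult_one by simp

lemma zero_smult [simp]: "v \<in> carrier V \<Longrightarrow> 0 \<odot> v = \<zero>"
  using smult_l_null by simp

lemma minus_one_smult: "v \<in> carrier V \<Longrightarrow> (- 1) \<odot> v = \<ominus> v"
  using add_smult[of v 1 "- 1"] by (metis M.add.m_comm M.minus_equality add.right_inverse one_smult smult_mem zero_smult)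

text \<open>Negation is scaling by -1, so closure under additive inverses comes for free.\<close>

lemma subspaceI:
  assumes "S \<subseteq> carrier V" "\<zero> \<in> S" "\<And>v w. \<lbrakk>v \<in> S; w \<in> S\<rbrakk> \<Longrightarrow> v \<oplus> w \<in> S"
    and "\<And>a v. v \<in> S \<Longrightarrow> a \<odot> v \<in> S"
  shows "submodule S complex_ring V"
proof (rule submoduleI)
  show "\<ominus> v \<in> S" if "v \<in> S" for v
    using minus_one_smult[of v] assms(4)[OF that, of "-1"] assms(1) that by auto
qed (use assms in auto)

lemma subspaceD:
  assumes "submodule S complex_ring V"
  shows "S \<subseteq> carrier V" "\<zero> \<in> S" "\<And>v w. \<lbrakk>v \<in> S; w \<in> S\<rbrakk> \<Longrightarrow> v \<oplus> w \<in> S"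
    "\<And>a v. v \<in> S \<Longrightarrow> a \<odot> v \<in> S"
proof -
  show sub: "S \<subseteq> carrier V"
    and "\<And>v w. \<lbrakk>v \<in> S; w \<in> S\<rbrakk> \<Longrightarrow> v \<oplus> w \<in> S" and sm: "\<And>a v. v \<in> S \<Longrightarrow> a \<odot> v \<in> S"
    using submoduleE[OF assms] by auto
  from submoduleE(2)[OF assms] obtain v where "v \<in> S" by auto
  then show "\<zero> \<in> S" using sm[of v 0] sub by auto
qed

lemma subspace_abelian:
  assumes "submodule S complex_ring V"
  shows "abelian_subgroup S V"
  using assms by (intro abelian_subgroupI3 additive_subgroup.intro M.abelian_group_axioms)
    (auto simp: submodule_def)

lemma quot_carrier: "carrier (quot_module V S) = (\<lambda>v. S +> v) ` carrier V"
  by (auto simp: quot_module_def FactRing_def A_RCOSETS_def')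

lemma quot_zero: "\<zero>\<^bsub>quot_module V S\<^esub> = S"
  by (simp add: quot_module_def FactRing_def)

lemma quot_add:
  assumes "submodule S complex_ring V" "v \<in> carrier V" "w \<in> carrier V"
  shows "(S +> v) \<oplus>\<^bsub>quot_module V S\<^esub> (S +> w) = S +> (v \<oplus> w)"
  using abelian_subgroup.a_rcos_sum[OF subspace_abelian] assms
  by (simp add: quot_module_def FactRing_def)

lemma quot_smult:
  assumes S: "submodule S complex_ring V" and v: "v \<in> carrier V"
  shows "a \<odot>\<^bsub>quot_module V S\<^esub> (S +> v) = S +> (a \<odot> v)"
proof -
  note D = subspaceD[OF S]
  have "(\<lambda>w. a \<odot> w) ` (S +> v) <+> S = S +> (a \<odot> v)" (is "?l = ?r")
  proof
    show "?l \<subseteq> ?r"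
    proof
      fix x assume "x \<in> ?l"
      then obtain s t where s: "s \<in> S" "t \<in> S" "x = a \<odot> (s \<oplus> v) \<oplus> t"
        unfolding set_add_def' a_r_coset_def' by auto
      then have c: "s \<in> carrier V" "t \<in> carrier V" "a \<odot> s \<in> carrier V" "a \<odot> v \<in> carrier V"
        using D(1) v by auto
      then have "x = (a \<odot> s \<oplus> t) \<oplus> a \<odot> v"
        using s v by (simp add: smult_add M.a_ac)
      moreover have "a \<odot> s \<oplus> t \<in> S"
        using s D by auto
      ultimately show "x \<in> ?r"
        unfolding a_r_coset_def' by auto
    qed
    show "?r \<subseteq> ?l"
    proof
      fix x assume "x \<in> ?r"
      then obtain s where s: "s \<in> S" "x = s \<oplus> a \<odot> v"
        unfolding a_r_coset_def' by auto
      \<comment> \<open>Taking \<open>v\<close> itself as the coset member and \<open>s\<close> as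
        the added element of \<open>S\<close> avoids dividing by \<open>a\<close>, so a = 0 is
        covered.\<close>
      then have "x = a \<odot> (\<zero> \<oplus> v) \<oplus> s"
        using v D(1) by (auto simp: M.a_comm)
      then show "x \<in> ?l"
        unfolding set_add_def' a_r_coset_def' using s D(2) by blast
    qed
  qed
  then show ?thesis
    by (simp add: quot_module_def)
qed

lemma quot_coset_eq_iff:
  assumes S: "submodule S complex_ring V" and v: "v \<in> carrier V"
  shows "S +> v = S \<longleftrightarrow> v \<in> S"
proof
  interpret S: abelian_subgroup S V
    using S by (rule subspace_abelian)
  show "v \<in> S" if "S +> v = S"
    using S.a_rcos_self[OF v] that by simp
  show "S +> v = S" if "v \<in> S"
    using S.a_rcos_const[OF that] .
qed

lemma quot_coset_cong:
  assumes S: "submodule S complex_ring V" and v: "v \<in> carrier V" and w: "w \<in> carrier V"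
    and vw: "v \<ominus> w \<in> S"
  shows "S +> v = S +> w"
proof -
  interpret S: abelian_subgroup S V
    using S by (rule subspace_abelian)
  have "v = (v \<ominus> w) \<oplus> w"
    using v w by (simp add: M.minus_eq M.a_assoc M.l_neg)
  then have "v \<in> S +> w"
    unfolding a_r_coset_def' using vw by blast
  then show ?thesis
    using S.a_repr_independence'[OF _ w] by simp
qed

text \<open>The whole carrier is one of the submodules being intersected, which keeps the span
  inside the carrier.\<close>

lemma lin_span_subspace:
  assumes "S \<subseteq> carrier V"
  shows "submodule (lin_span V S) complex_ring V" "S \<subseteq> lin_span V S"
proof -
  have c: "submodule (carrier V) complex_ring V"
    by (rule subspaceI) auto
  show "submodule (lin_span V S) complex_ring V"
  proof (rule subspaceI)
    show "lin_span V S \<subseteq> carrier V"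
      unfolding lin_span_def using c assms by blast
  qed (auto simp: lin_span_def dest: subspaceD)
  show "S \<subseteq> lin_span V S"
    by (auto simp: lin_span_def)
qed

text \<open>
  If \<open>T\<close> vanishes then its kernel is everything and its image is zero, so that the cohomology
  consists of the singleton cosets.
\<close>

lemma dirac_cohomology_nonzero:
  assumes T: "\<And>v. v \<in> carrier V \<Longrightarrow> T v = \<zero>" and V: "carrier V \<noteq> {\<zero>}"
  shows "carrier (dirac_cohomology V T) \<noteq> {\<zero>\<^bsub>dirac_cohomology V T\<^esub>}"
proof -
  have ker: "dirac_ker V T = carrier V"
    using T by (auto simp: dirac_ker_def)
  have im: "T ` carrier V = {\<zero>}"
    using T M.zero_closed by (auto simp del: M.zero_closed)
  obtain v where v: "v \<in> carrier V" "v \<noteq> \<zero>"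
    using V M.zero_closed by blast
  have "dirac_cohomology V T = quot_module V {\<zero>}"
    using im by (simp add: dirac_cohomology_def ker)
  moreover have "{\<zero>} +> v = {v}"
    using v by (simp add: a_r_coset_def')
  moreover have "{\<zero>} +> v \<in> carrier (quot_module V {\<zero>})"
    using v by (simp add: quot_carrier)
  ultimately show ?thesis
    using v quot_zero[of "{\<zero>}"] by auto
qed

end

section \<open>Algebras given by generators and relations\<close>

text \<open>An update at a fresh key is the addition of a monomial, so update induction becomes
  induction over sums. The bound \<open>A\<close> on the support is carried along so that the rule
  can be used inside carriers.\<close>

lemma poly_mapping_add_induct [consumes 1, case_names zero single add]:
  fixes p :: "'a \<Rightarrow>\<^sub>0 'b::comm_monoid_add"
  assumes "Poly_Mapping.keys p \<subseteq> A" and "P 0"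
    and single: "\<And>k a. k \<in> A \<Longrightarrow> P (Poly_Mapping.single k a)"
    and add: "\<And>p q. \<lbrakk>Poly_Mapping.keys p \<subseteq> A; Poly_Mapping.keys q \<subseteq> A; P p; P q\<rbrakk> \<Longrightarrow> P (p + q)"
  shows "P p"
  using assms(1)
proof (induction p rule: update_induct)
  case const
  then show ?case by (simp add: assms(2))
next
  case (update f a b)
  have upd: "Poly_Mapping.update a b f = Poly_Mapping.single a b + f"
    by (rule poly_mapping_eqI)
      (use update.hyps in \<open>auto simp: lookup_add lookup_update lookup_single when_def in_keys_iff\<close>)
  have "Poly_Mapping.keys f \<subseteq> A" "a \<in> A"
    using update.prems update.hyps by (auto simp: keys_update split: if_splits)
  then show ?case
    unfolding upd using update.IH by (intro add single) auto
qed

section \<open>The free algebra as a ring and a complex vector space\<close>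

lemma free_algebra_simps [simp]:
  "\<one>\<^bsub>free_algebra A\<^esub> = 1" "\<zero>\<^bsub>free_algebra A\<^esub> = 0" "p \<otimes>\<^bsub>free_algebra A\<^esub> q = p * q"
  "p \<oplus>\<^bsub>free_algebra A\<^esub> q = p + q" "a \<odot>\<^bsub>free_algebra A\<^esub> p = scal a * p"
  by (simp_all add: free_algebra_def)

lemma free_carrier_iff:
  "p \<in> carrier (free_algebra A) \<longleftrightarrow> Poly_Mapping.keys p \<subseteq> {w. set (letters w) \<subseteq> A}"
  by (auto simp: free_algebra_def)

lemma free_carrier_mono: "A \<subseteq> B \<Longrightarrow> carrier (free_algebra A) \<subseteq> carrier (free_algebra B)"
  by (fastforce simp: free_carrier_iff)

lemma free_carrier_closed [simp, intro]:
  "0 \<in> carrier (free_algebra A)"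
  "1 \<in> carrier (free_algebra A)"
  "scal a \<in> carrier (free_algebra A)"
  "g \<in> A \<Longrightarrow> gen_of g \<in> carrier (free_algebra A)"
  by (auto simp: free_carrier_iff scal_def gen_of_def zero_word_def one_poly_mapping.rep_eq
      in_keys_iff lookup_single when_def split: if_splits)

lemma free_carrier_add [simp, intro]:
  "\<lbrakk>p \<in> carrier (free_algebra A); q \<in> carrier (free_algebra A)\<rbrakk> \<Longrightarrow> p + q \<in> carrier (free_algebra A)"
  using Poly_Mapping.keys_add[of p q] by (auto simp: free_carrier_iff)

lemma free_carrier_mult [simp, intro]:
  "\<lbrakk>p \<in> carrier (free_algebra A); q \<in> carrier (free_algebra A)\<rbrakk> \<Longrightarrow> p * q \<in> carrier (free_algebra A)"
proof -
  assume "p \<in> carrier (free_algebra A)" "q \<in> carrier (free_algebra A)"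
  then have "{a + b |a b. a \<in> Poly_Mapping.keys p \<and> b \<in> Poly_Mapping.keys q} \<subseteq> {w. set (letters w) \<subseteq> A}"
    unfolding free_carrier_iff plus_word_def by fastforce
  then show ?thesis
    using keys_mult[of p q] unfolding free_carrier_iff by (rule order_trans[rotated])
qed

lemma free_carrier_uminus [simp, intro]:
  "p \<in> carrier (free_algebra A) \<Longrightarrow> - p \<in> carrier (free_algebra A)"
  by (simp add: free_carrier_iff)

lemma free_carrier_diff [simp, intro]:
  "\<lbrakk>p \<in> carrier (free_algebra A); q \<in> carrier (free_algebra A)\<rbrakk> \<Longrightarrow> p - q \<in> carrier (free_algebra A)"
  using free_carrier_add[of p A "- q"] by simp

lemma free_carrier_sum [simp, intro]:
  "(\<And>i. i \<in> I \<Longrightarrow> f i \<in> carrier (free_algebra A)) \<Longrightarrow> sum f I \<in> carrier (free_algebra A)"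
  by (induction I rule: infinite_finite_induct) auto

lemma scal_simps [simp]: "scal 0 = 0" "scal 1 = 1" "scal (- a) = - scal a"
  by (simp_all add: scal_def single_uminus)

lemma scal_add: "scal (a + b) = scal a + scal b"
  by (simp add: scal_def single_add)

lemma scal_mult: "scal (a * b) = scal a * scal b"
  by (simp add: scal_def mult_single)

text \<open>Scalars are supported at the empty word, which is neutral on both sides, so they are
  central.\<close>

lemma scal_commute: "p * scal a = scal a * p"
proof -
  have "Poly_Mapping.keys p \<subseteq> UNIV" by simp
  then show ?thesis
  proof (induction p rule: poly_mapping_add_induct)
    case (single k b)
    then show ?case by (simp add: scal_def mult_single mult.commute)
  qed (simp_all add: algebra_simps)
qed

lemma scal_pull: "p * (scal a * q) = scal a * (p * q)"
  by (simp add: scal_commute flip: mult.assoc)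

lemma single_conv_scal: "Poly_Mapping.single w a = scal a * Poly_Mapping.single w 1"
  by (simp add: scal_def mult_single)

lemma single_word_Cons:
  "Poly_Mapping.single (Word (g # gs)) 1 = gen_of g * Poly_Mapping.single (Word gs) (1::complex)"
  by (simp add: gen_of_def mult_single plus_word_def)

text \<open>Words arise from the empty word by prepending letters, so left multiplication by
  generators, scaling and addition reach every polynomial over \<open>A\<close>. Zero is covered as
  0 times 1.\<close>

lemma free_algebra_induct [consumes 1, case_names one scal gen add]:
  assumes p: "p \<in> carrier (free_algebra A)"
    and one: "P 1"
    and scal: "\<And>a p. \<lbrakk>p \<in> carrier (free_algebra A); P p\<rbrakk> \<Longrightarrow> P (scal a * p)"
    and gen: "\<And>g p. \<lbrakk>g \<in> A; p \<in> carrier (free_algebra A); P p\<rbrakk> \<Longrightarrow> P (gen_of g * p)"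
    and add: "\<And>p q. \<lbrakk>p \<in> carrier (free_algebra A); q \<in> carrier (free_algebra A); P p; P q\<rbrakk> \<Longrightarrow> P (p + q)"
  shows "P p"
  using p unfolding free_carrier_iff
proof (induction p rule: poly_mapping_add_induct)
  case zero
  show ?case using scal[OF _ one, of 0] by simp
next
  case (single w a)
  have mem: "set gs \<subseteq> A \<Longrightarrow> Poly_Mapping.single (Word gs) (1::complex) \<in> carrier (free_algebra A)" for gs
    by (simp add: free_carrier_iff)
  have "set gs \<subseteq> A \<Longrightarrow> P (Poly_Mapping.single (Word gs) (1::complex))" for gs
  proof (induction gs)
    case Nil
    show ?case using one by (simp flip: zero_word_def)
  next
    case (Cons g gs)
    then show ?case
      unfolding single_word_Cons by (intro gen mem) auto
  qed
  moreover obtain gs where "w = Word gs" by (cases w)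
  ultimately show ?case
    using single unfolding single_conv_scal[of w a] by (intro scal) (auto intro: mem)
next
  case (add p q)
  then show ?case by (intro assms(5)) (auto simp: free_carrier_iff)
qed

lemma ring_free_algebra: "ring (free_algebra A)"
proof (rule ringI)
  show "abelian_group (free_algebra A)"
  proof (rule abelian_groupI)
    fix p assume "p \<in> carrier (free_algebra A)"
    then show "\<exists>q\<in>carrier (free_algebra A). q \<oplus>\<^bsub>free_algebra A\<^esub> p = \<zero>\<^bsub>free_algebra A\<^esub>"
      by (intro bexI[of _ "- p"]) auto
  qed (auto simp: add.assoc add.commute)
  show "Group.monoid (free_algebra A)"
    by (rule Group.monoidI) (auto simp: mult.assoc)
qed (auto simp: distrib_left distrib_right)

lemma module_free_algebra: "Module.module complex_ring (free_algebra A)"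
  by (rule module_complexI)
    (auto simp: scal_add scal_mult mult.assoc distrib_left distrib_right intro: ring.is_abelian_group[OF ring_free_algebra])

section \<open>Quotients of the free algebra by the ideal of the relations\<close>

locale presentation =
  fixes A :: "'g set" and R :: "'g free set"
  assumes rels: "R \<subseteq> carrier (free_algebra A)"
begin

sublocale F: complex_space "free_algebra A"
  by (simp add: complex_space_def module_free_algebra)

sublocale I: ideal "genideal (free_algebra A) R" "free_algebra A"
  using ring.genideal_ideal[OF ring_free_algebra rels] .

abbreviation rel_ideal where "rel_ideal \<equiv> genideal (free_algebra A) R"

abbreviation cls where "cls \<equiv> pres_class A R"

lemma a_minus_eq: "\<lbrakk>p \<in> carrier (free_algebra A); q \<in> carrier (free_algebra A)\<rbrakk>
    \<Longrightarrow> p \<ominus>\<^bsub>free_algebra A\<^esub> q = p - q"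
  using F.M.minus_equality[of "- q" q] by (simp add: a_minus_def)

lemma rel_ideal_zero [simp]: "0 \<in> rel_ideal"
  using I.zero_closed by simp

lemma rel_ideal_add: "\<lbrakk>p \<in> rel_ideal; q \<in> rel_ideal\<rbrakk> \<Longrightarrow> p + q \<in> rel_ideal"
  using I.a_closed by simp

lemma rel_ideal_mult_left: "\<lbrakk>p \<in> rel_ideal; q \<in> carrier (free_algebra A)\<rbrakk> \<Longrightarrow> q * p \<in> rel_ideal"
  using I.I_l_closed by simp

lemma rel_ideal_mult_right: "\<lbrakk>p \<in> rel_ideal; q \<in> carrier (free_algebra A)\<rbrakk> \<Longrightarrow> p * q \<in> rel_ideal"
  using I.I_r_closed by simp

lemma rel_ideal_uminus: "p \<in> rel_ideal \<Longrightarrow> - p \<in> rel_ideal"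
  using rel_ideal_mult_left[of p "- 1"] by auto

lemma rel_ideal_diff: "\<lbrakk>p \<in> rel_ideal; q \<in> rel_ideal\<rbrakk> \<Longrightarrow> p - q \<in> rel_ideal"
  using rel_ideal_add[of p "- q"] rel_ideal_uminus by simp

lemma rel_ideal_sum: "(\<And>i. i \<in> S \<Longrightarrow> f i \<in> rel_ideal) \<Longrightarrow> sum f S \<in> rel_ideal"
  by (induction S rule: infinite_finite_induct) (auto intro: rel_ideal_add)

lemma rels_rel_ideal: "p \<in> R \<Longrightarrow> p \<in> rel_ideal"
  by (auto simp: genideal_def)

lemma rel_ideal_subspace: "submodule rel_ideal complex_ring (free_algebra A)"
  by (rule F.subspaceI) (auto simp: I.a_subset intro: rel_ideal_add rel_ideal_mult_left)

lemma cls_eq: "cls p = rel_ideal +>\<^bsub>free_algebra A\<^esub> p"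
  by (simp add: pres_class_def)

lemma cls_mem [simp, intro]:
  "p \<in> carrier (free_algebra A) \<Longrightarrow> cls p \<in> carrier (presented_algebra A R)"
  by (simp add: cls_eq presented_algebra_def F.quot_carrier)

lemma cls_add: "\<lbrakk>p \<in> carrier (free_algebra A); q \<in> carrier (free_algebra A)\<rbrakk>
    \<Longrightarrow> cls (p + q) = cls p \<oplus>\<^bsub>presented_algebra A R\<^esub> cls q"
  using F.quot_add[OF rel_ideal_subspace] by (simp add: cls_eq presented_algebra_def)

lemma cls_scal: "p \<in> carrier (free_algebra A)
    \<Longrightarrow> cls (scal a * p) = a \<odot>\<^bsub>presented_algebra A R\<^esub> cls p"
  using F.quot_smult[OF rel_ideal_subspace] by (simp add: cls_eq presented_algebra_def)

lemma cls_mult: "\<lbrakk>p \<in> carrier (free_algebra A); q \<in> carrier (free_algebra A)\<rbrakk>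
    \<Longrightarrow> cls (p * q) = cls p \<otimes>\<^bsub>presented_algebra A R\<^esub> cls q"
  using I.rcoset_mult_add[of p q]
  by (simp add: cls_eq presented_algebra_def quot_module_def FactRing_def)

lemma cls_one: "cls 1 = \<one>\<^bsub>presented_algebra A R\<^esub>"
  by (simp add: cls_eq presented_algebra_def quot_module_def FactRing_def)

lemma cls_zero_iff: "p \<in> carrier (free_algebra A)
    \<Longrightarrow> cls p = \<zero>\<^bsub>presented_algebra A R\<^esub> \<longleftrightarrow> p \<in> rel_ideal"
  using F.quot_coset_eq_iff[OF rel_ideal_subspace] by (simp add: cls_eq presented_algebra_def F.quot_zero)

lemma cls_cong: "\<lbrakk>p \<in> carrier (free_algebra A); q \<in> carrier (free_algebra A); p - q \<in> rel_ideal\<rbrakk>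
    \<Longrightarrow> cls p = cls q"
  unfolding cls_eq by (rule F.quot_coset_cong[OF rel_ideal_subspace]) (auto simp: a_minus_eq)

text \<open>Induction on the polynomial puts its class into every subalgebra \<open>T\<close> of the
  defining intersection. In type D this places the Dirac element in \<open>H_D\<close>.\<close>

lemma subalgebra_gen_cls:
  assumes B: "B \<subseteq> A" and p: "p \<in> carrier (free_algebra B)"
  shows "cls p \<in> carrier (subalgebra_gen (presented_algebra A R) ((\<lambda>g. cls (gen_of g)) ` B))"
proof -
  have "cls p \<in> T" if T: "(\<lambda>g. cls (gen_of g)) ` B \<subseteq> T"
    "submodule T complex_ring (presented_algebra A R)" "\<one>\<^bsub>presented_algebra A R\<^esub> \<in> T"
    "\<forall>a\<in>T. \<forall>b\<in>T. a \<otimes>\<^bsub>presented_algebra A R\<^esub> b \<in> T" for T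
    using p
  proof (induction p rule: free_algebra_induct)
    case one
    show ?case using T(3) by (simp add: cls_one)
  next
    case (scal a p)
    then have "p \<in> carrier (free_algebra A)"
      using free_carrier_mono[OF B] by auto
    then show ?case
      using scal(2) submodule.smult_closed[OF T(2), of a "cls p"] by (simp add: cls_scal)
  next
    case (gen g p)
    then have "p \<in> carrier (free_algebra A)" "g \<in> A"
      using B free_carrier_mono[OF B] by auto
    moreover have "cls (gen_of g) \<in> T"
      using gen T(1) by auto
    ultimately show ?case
      using gen(3) T(4) by (simp add: cls_mult)
  next
    case (add p q)
    then have "p \<in> carrier (free_algebra A)" "q \<in> carrier (free_algebra A)"
      using free_carrier_mono[OF B] by auto
    then show ?case
      using subgroup.m_closed[OF submodule.axioms(1)[OF T(2)] add(3,4)] by (simp add: cls_add)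
  qed
  then show ?thesis
    by (auto simp: subalgebra_gen_def)
qed

end

section \<open>Modules over a presented algebra\<close>

locale presented_module = presentation A R + M: algebra_module "presented_algebra A R" V act
  for A :: "'g set" and R :: "'g free set" and V :: "(complex, 'v) module"
    and act :: "'g free set \<Rightarrow> 'v \<Rightarrow> 'v"
begin

sublocale V: complex_space V
  by (simp add: complex_space_def M.V.module_axioms)

text \<open>Polynomials in the generators act directly on the module, so computations take place in
  the free algebra and the relations enter only through \<open>op_cong\<close>.\<close>

definition op where "op p v = act (cls p) v"

lemma op_mem [simp, intro]:
  "\<lbrakk>p \<in> carrier (free_algebra A); v \<in> carrier V\<rbrakk> \<Longrightarrow> op p v \<in> carrier V"
  by (simp add: op_def M.act_closed)

lemma op_add: "\<lbrakk>p \<in> carrier (free_algebra A); q \<in> carrier (free_algebra A); v \<in> carrier V\<rbrakk>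
    \<Longrightarrow> op (p + q) v = op p v \<oplus>\<^bsub>V\<^esub> op q v"
  by (simp add: op_def cls_add M.act_add_left)

lemma op_scal: "\<lbrakk>p \<in> carrier (free_algebra A); v \<in> carrier V\<rbrakk>
    \<Longrightarrow> op (scal a * p) v = a \<odot>\<^bsub>V\<^esub> op p v"
  by (simp add: op_def cls_scal M.act_smult_left)

lemma op_mult: "\<lbrakk>p \<in> carrier (free_algebra A); q \<in> carrier (free_algebra A); v \<in> carrier V\<rbrakk>
    \<Longrightarrow> op (p * q) v = op p (op q v)"
  by (simp add: op_def cls_mult M.act_mult)

lemma op_zero [simp]: "v \<in> carrier V \<Longrightarrow> op 0 v = \<zero>\<^bsub>V\<^esub>"
  using op_scal[of 0 v 0] V.zero_smult[OF op_mem[of 0 v]] by simp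

lemma op_one [simp]: "v \<in> carrier V \<Longrightarrow> op 1 v = v"
  by (simp add: op_def cls_one M.act_one)

lemma op_vector_add: "\<lbrakk>p \<in> carrier (free_algebra A); v \<in> carrier V; w \<in> carrier V\<rbrakk>
    \<Longrightarrow> op p (v \<oplus>\<^bsub>V\<^esub> w) = op p v \<oplus>\<^bsub>V\<^esub> op p w"
  by (simp add: op_def M.act_add_right)

lemma op_vector_smult: "\<lbrakk>p \<in> carrier (free_algebra A); v \<in> carrier V\<rbrakk>
    \<Longrightarrow> op p (a \<odot>\<^bsub>V\<^esub> v) = a \<odot>\<^bsub>V\<^esub> op p v"
  by (simp add: op_def M.act_smult_right)

lemma op_cong: "\<lbrakk>p \<in> carrier (free_algebra A); q \<in> carrier (free_algebra A); p - q \<in> rel_ideal\<rbrakk>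
    \<Longrightarrow> op p v = op q v"
  by (simp add: op_def cls_cong[of p q])

lemma op_sum_cong:
  assumes "\<And>i. i \<in> S \<Longrightarrow> f i \<in> carrier (free_algebra A)" "\<And>i. i \<in> S \<Longrightarrow> g i \<in> carrier (free_algebra A)"
    and "\<And>i. i \<in> S \<Longrightarrow> op (f i) v = op (g i) v" and "v \<in> carrier V"
  shows "op (sum f S) v = op (sum g S) v"
  using assms by (induction S rule: infinite_finite_induct) (auto simp: op_add)

end

section \<open>Reflections and Weyl groups\<close>

lemma std_basis_simps [simp]: "std_basis i i = 1" "j \<noteq> i \<Longrightarrow> std_basis i j = 0"
  by (simp_all add: std_basis_def)

lemma std_basis_apply: "std_basis i j = (if j = i then 1 else 0)"
  by (simp add: std_basis_def)

lemma std_basis_inject [simp]: "std_basis i = std_basis j \<longleftrightarrow> i = j"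
  by (metis std_basis_simps zero_neq_one)

lemma ip_std_basis [simp]:
  assumes "i \<in> {1..n}"
  shows "ip n v (std_basis i) = v i"
proof -
  have "ip n v (std_basis i) = (\<Sum>l\<in>{1..n}. if l = i then v l else 0)"
    unfolding ip_def by (rule sum.cong) (auto simp: std_basis_def)
  then show ?thesis using assms by simp
qed

lemma ip_add_right: "ip n v (a + b) = ip n v a + ip n v b"
  by (simp add: ip_def distrib_left sum.distrib)

lemma ip_diff_right: "ip n v (a - b) = ip n v a - ip n v b"
  by (simp add: ip_def right_diff_distrib sum_subtractf)

lemma ip_uminus [simp]: "ip n v (- a) = - ip n v a" "ip n (- v) a = - ip n v a"
  by (simp_all add: ip_def sum_negf)

lemma reflection_uminus [simp]: "reflection n (- \<alpha>) = reflection n \<alpha>"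
  by (intro ext) (simp add: reflection_def)

lemma reflection_diff:
  assumes "i \<in> {1..n}" "j \<in> {1..n}" "i \<noteq> j"
  shows "refl_ij n i j v = (\<lambda>l. if l = i then v j else if l = j then v i else v l)"
  using assms by (intro ext) (auto simp: reflection_def ip_diff_right std_basis_apply diff_divide_distrib add_divide_distrib)

lemma reflection_plus:
  assumes "i \<in> {1..n}" "j \<in> {1..n}" "i \<noteq> j"
  shows "reflection n (std_basis i + std_basis j) v
    = (\<lambda>l. if l = i then - v j else if l = j then - v i else v l)"
  using assms by (intro ext) (auto simp: reflection_def ip_add_right std_basis_apply diff_divide_distrib add_divide_distrib)

lemma reflection_short:
  assumes "i \<in> {1..n}"
  shows "reflection n (std_basis i) v = (\<lambda>l. if l = i then - v i else v l)"
  using assms by (intro ext) (auto simp: reflection_def std_basis_apply)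

lemma refl_ij_commute: "refl_ij n i j = refl_ij n j i"
  using reflection_uminus[of n "std_basis i - std_basis j"] by simp

text \<open>Among the short reflections only that of e_n acts by a prescribed formula in type B; the
  others are reached from it by this conjugation.\<close>

lemma reflection_conj_short:
  assumes "i \<in> {1..n}" "j \<in> {1..n}" "i \<noteq> j"
  shows "refl_ij n i j \<circ> (reflection n (std_basis j) \<circ> refl_ij n i j) = reflection n (std_basis i)"
  using assms by (intro ext) (simp add: reflection_diff reflection_short)

text \<open>A sign change in coordinate \<open>j\<close> turns e_i - e_j into e_i + e_j, whose
  reflection has no prescribed action either.\<close>

lemma reflection_conj_plus:
  assumes "i \<in> {1..n}" "j \<in> {1..n}" "i \<noteq> j"
  shows "reflection n (std_basis j) \<circ> (refl_ij n i j \<circ> reflection n (std_basis j))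
    = reflection n (std_basis i + std_basis j)"
  using assms by (intro ext) (simp add: reflection_diff reflection_plus reflection_short)

section \<open>Weyl groups and the symmetric group inside them\<close>

lemma weyl_reflection: "\<alpha> \<in> R \<Longrightarrow> reflection n \<alpha> \<in> weyl n R"
  using weyl_refl[OF _ weyl_id, of \<alpha> R n] by simp

lemma weyl_comp:
  assumes "w \<in> weyl n R" "w' \<in> weyl n R"
  shows "w \<circ> w' \<in> weyl n R"
  using assms by (induction w rule: weyl.induct) (auto simp: o_assoc[symmetric] intro: weyl_refl)

lemma weyl_mono:
  assumes "R \<subseteq> S"
  shows "weyl n R \<subseteq> weyl n S"
proof
  show "w \<in> weyl n S" if "w \<in> weyl n R" for w
    using that
  proof induction
    case weyl_id
    show ?case by (rule weyl.weyl_id)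
  next
    case (weyl_refl \<alpha> w)
    then show ?case
      using assms by (intro weyl.weyl_refl) auto
  qed
qed

lemma weyl_refl_ij:
  assumes "pos_roots_A n \<subseteq> R" "i \<in> {1..n}" "j \<in> {1..n}" "i \<noteq> j"
  shows "refl_ij n i j \<in> weyl n R"
proof -
  have "refl_ij n i j \<in> weyl n R" if "1 \<le> i" "i < j" "j \<le> n" for i j
    using that assms(1) by (intro weyl_reflection) (auto simp: pos_roots_A_def)
  from this[of i j] this[of j i] show ?thesis
    using assms(2-4) refl_ij_commute[of n i j] by (cases "i < j") auto
qed

text \<open>Each reflection of type A transposes two basis vectors. Together with injectivity of
  \<open>std_basis\<close> this makes the description in \<open>perm_index\<close> determine an
  index.\<close>

lemma weyl_A_std_basis:
  assumes "w \<in> weyl n (roots_A n)" "i \<in> {1..n}"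
  shows "\<exists>j\<in>{1..n}. w (std_basis i) = std_basis j"
  using assms
proof (induction w rule: weyl.induct)
  case (weyl_refl \<alpha> w)
  then obtain l where l: "l \<in> {1..n}" "w (std_basis i) = std_basis l"
    by auto
  obtain p q where pq: "p \<in> {1..n}" "q \<in> {1..n}" "p \<noteq> q" "reflection n \<alpha> = refl_ij n p q"
  proof -
    obtain p q where "1 \<le> p" "p < q" "q \<le> n" "\<alpha> = std_basis p - std_basis q \<or> \<alpha> = - (std_basis p - std_basis q)"
      using weyl_refl.hyps(1) by (auto simp: roots_A_def pos_roots_A_def)
    then show thesis
      using reflection_uminus[of n "std_basis p - std_basis q"] by (intro that[of p q]) auto
  qed
  have "refl_ij n p q (std_basis l) = std_basis (if l = p then q else if l = q then p else l)"
    using pq by (subst reflection_diff) (auto simp: std_basis_apply fun_eq_iff)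
  then show ?case
    using l pq by (auto split: if_splits)
qed auto

lemma perm_index_mem:
  assumes "w \<in> weyl n (roots_A n)" "i \<in> {1..n}"
  shows "perm_index w i \<in> {1..n}"
proof -
  obtain j where "j \<in> {1..n}" "w (std_basis i) = std_basis j"
    using weyl_A_std_basis[OF assms] by auto
  moreover from this have "perm_index w i = j"
    unfolding perm_index_def by (intro the_equality) auto
  ultimately show ?thesis by simp
qed

lemma root_set_subsets: "pos_roots_A n \<subseteq> roots_A n" "pos_roots_A n \<subseteq> roots_B n"
    "pos_roots_A n \<subseteq> roots_D n" "roots_A n \<subseteq> roots_B n" "roots_D n \<subseteq> roots_B n"
    "pos_roots_B n \<subseteq> roots_B n" "pos_roots_D n \<subseteq> roots_D n"
  unfolding roots_A_def roots_B_def roots_D_def pos_roots_A_def pos_roots_B_def pos_roots_D_def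
  by blast+

section \<open>The relations and the Dirac element as polynomials in the generators\<close>

lemma gens_mem [simp]:
  "Xgen i \<in> gens n W \<longleftrightarrow> i \<in> {1..n}" "Cgen i \<in> gens n W \<longleftrightarrow> i \<in> {1..n}"
  "Wgen w \<in> gens n W \<longleftrightarrow> w \<in> W"
  by (auto simp: gens_def)

lemma gens_mono: "W \<subseteq> W' \<Longrightarrow> gens n W \<subseteq> gens n W'"
  by (auto simp: gens_def)

lemma clifford_rels_carrier:
  assumes "Cgen ` {1..n} \<subseteq> A"
  shows "clifford_rels n \<subseteq> carrier (free_algebra A)"
proof -
  have "cc i \<in> carrier (free_algebra A)" if "i \<in> {1..n}" for i
    using assms that by (intro free_carrier_closed(4)) auto
  then show ?thesis
    unfolding clifford_rels_def by auto
qed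

text \<open>The hypotheses on \<open>W\<close> ensure that every group element named in a relation
  is a generator: adjacent transpositions, the identity and products. The Clifford indices stay in
  range by \<open>perm_index_mem\<close>.\<close>

lemma common_rels_carrier:
  assumes "weyl n (roots_A n) \<subseteq> W" "id \<in> W" "\<And>w w'. \<lbrakk>w \<in> W; w' \<in> W\<rbrakk> \<Longrightarrow> w \<circ> w' \<in> W"
  shows "common_rels n W k \<subseteq> carrier (free_algebra (gens n W))"
proof -
  have "refl_ij n i (i + 1) \<in> W" if "1 \<le> i" "i < n" for i
    using weyl_refl_ij[of n "roots_A n" i "i + 1"] that assms(1) root_set_subsets by auto
  moreover have "perm_index w i \<in> {1..n}" if "w \<in> weyl n (roots_A n)" "i \<in> {1..n}" for w i
    using that by (rule perm_index_mem)
  moreover have "clifford_rels n \<subseteq> carrier (free_algebra (gens n W))"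
    by (rule clifford_rels_carrier) auto
  ultimately show ?thesis
    using assms unfolding common_rels_def group_rels_def
    by (intro Un_least; (elim CollectE exE conjE | clarsimp)?)
       (auto intro!: free_carrier_closed(4) free_carrier_mult free_carrier_add free_carrier_diff free_carrier_uminus)
qed

lemma presentation_A: "presentation (gens n (weyl n (roots_A n))) (rels_A n k)"
proof
  show "rels_A n k \<subseteq> carrier (free_algebra (gens n (weyl n (roots_A n))))"
    unfolding rels_A_def
    using common_rels_carrier[of n "weyl n (roots_A n)" "\<lambda>_. k"] weyl_id weyl_comp
    by (auto intro!: free_carrier_closed(4))
qed

lemma reflection_short_weyl: "i \<in> {1..n} \<Longrightarrow> reflection n (std_basis i) \<in> weyl n (roots_B n)"
  by (rule weyl_reflection) (auto simp: roots_B_def pos_roots_B_def)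

text \<open>The relations for the last short reflection mention the generators of index
  \<open>n\<close>, which exist only if n is at least 1.\<close>

lemma presentation_B:
  assumes "1 \<le> n"
  shows "presentation (gens n (weyl n (roots_B n))) (rels_B n k N)"
proof
  have "common_rels n (weyl n (roots_B n)) k \<subseteq> carrier (free_algebra (gens n (weyl n (roots_B n))))"
    by (rule common_rels_carrier) (auto intro!: weyl_mono root_set_subsets weyl_id weyl_comp)
  moreover have "ww (reflection n (std_basis n)) \<in> carrier (free_algebra (gens n (weyl n (roots_B n))))"
    using assms by (auto intro!: free_carrier_closed(4) reflection_short_weyl)
  ultimately show "rels_B n k N \<subseteq> carrier (free_algebra (gens n (weyl n (roots_B n))))"
    unfolding rels_B_def Let_def using assms
    by (auto intro!: free_carrier_closed(4))
qed

lemma presentation_clifford: "presentation (Cgen ` {1..n}) (clifford_rels n)"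
  by standard (rule clifford_rels_carrier, simp)

lemma c_root_carrier [simp, intro]:
  "Cgen ` {1..n} \<subseteq> A \<Longrightarrow> c_root n \<alpha> \<in> carrier (free_algebra A)"
  unfolding c_root_def by (auto intro!: free_carrier_closed(4))

lemma dirac_carrier:
  assumes "\<And>\<alpha>. \<alpha> \<in> P \<Longrightarrow> reflection n \<alpha> \<in> W"
  shows "dirac n P k \<in> carrier (free_algebra (gens n W))"
proof -
  have "Cgen ` {1..n} \<subseteq> gens n W" by auto
  then show ?thesis
    unfolding dirac_def using assms
    by (intro free_carrier_add free_carrier_sum free_carrier_mult free_carrier_closed(3,4)
        c_root_carrier) auto
qed

section \<open>Root lengths and invariant parameters in type B\<close>

lemma weyl_invariantD:
  "\<lbrakk>weyl_invariant n R k; \<alpha> \<in> R; \<beta> \<in> R; reflection n \<beta> \<alpha> = \<gamma>\<rbrakk> \<Longrightarrow> k \<gamma> = k \<alpha>"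
  unfolding weyl_invariant_def using weyl_reflection by blast

lemma ip_long:
  assumes "i \<in> {1..n}" "j \<in> {1..n}" "i \<noteq> j"
  shows "ip n (std_basis i - std_basis j) (std_basis i - std_basis j) = 2"
    "ip n (std_basis i + std_basis j) (std_basis i + std_basis j) = 2"
  using assms by (simp_all add: ip_diff_right ip_add_right)

lemma roots_B_mem:
  "i \<in> {1..n} \<Longrightarrow> std_basis i \<in> roots_B n"
  "\<lbrakk>i \<in> {1..n}; j \<in> {1..n}; i \<noteq> j\<rbrakk> \<Longrightarrow> std_basis i + std_basis j \<in> roots_B n"
  "\<lbrakk>i \<in> {1..n}; j \<in> {1..n}; i \<noteq> j\<rbrakk> \<Longrightarrow> std_basis i - std_basis j \<in> roots_B n"
proof -
  show "std_basis i \<in> roots_B n" if "i \<in> {1..n}"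
    using that unfolding roots_B_def pos_roots_B_def by auto
  have p: "std_basis i + std_basis j \<in> roots_B n" "std_basis i - std_basis j \<in> roots_B n"
      "- (std_basis i - std_basis j) \<in> roots_B n"
    if "1 \<le> i" "i < j" "j \<le> n" for i j
    using that unfolding roots_B_def pos_roots_B_def pos_roots_D_def by blast+
  assume ij: "i \<in> {1..n}" "j \<in> {1..n}" "i \<noteq> j"
  then consider "1 \<le> i" "i < j" "j \<le> n" | "1 \<le> j" "j < i" "i \<le> n"
    by fastforce
  then show "std_basis i + std_basis j \<in> roots_B n" "std_basis i - std_basis j \<in> roots_B n"
    by (cases; use p[of i j] p[of j i] in \<open>simp add: add.commute\<close>)+
qed

lemma pos_roots_B_cases:
  assumes "\<alpha> \<in> pos_roots_B n"
  obtains (short) i where "i \<in> {1..n}" "\<alpha> = std_basis i"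
  | (long) i j where "i \<in> {1..n}" "j \<in> {1..n}" "i \<noteq> j"
      "\<alpha> = std_basis i - std_basis j \<or> \<alpha> = std_basis i + std_basis j"
  using assms unfolding pos_roots_B_def pos_roots_D_def
  by (elim UnE CollectE exE conjE; metis atLeastAtMost_iff le_trans less_imp_le less_irrefl)

lemma short_root_B_cases:
  assumes "\<beta> \<in> short_roots_B n"
  obtains i where "i \<in> {1..n}" "\<beta> = std_basis i \<or> \<beta> = - std_basis i"
proof -
  obtain \<alpha> where \<alpha>: "\<alpha> \<in> pos_roots_B n" "\<beta> = \<alpha> \<or> \<beta> = - \<alpha>"
    using assms by (auto simp: short_roots_B_def roots_B_def)
  have "ip n \<alpha> \<alpha> = 1"
    using assms \<alpha>(2) by (auto simp: short_roots_B_def)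
  with \<alpha>(1) show thesis
  proof (cases rule: pos_roots_B_cases)
    case (short i)
    then show thesis using that \<alpha>(2) by blast
  next
    case (long i j)
    then show thesis using ip_long[OF long(1-3)] \<open>ip n \<alpha> \<alpha> = 1\<close> by auto
  qed
qed

lemma long_root_B_cases:
  assumes "\<alpha> \<in> long_roots_B n"
  obtains \<beta> i j where "i \<in> {1..n}" "j \<in> {1..n}" "i \<noteq> j" "\<alpha> = \<beta> \<or> \<alpha> = - \<beta>"
    "\<beta> = std_basis i - std_basis j \<or> \<beta> = std_basis i + std_basis j"
proof -
  obtain \<beta> where \<beta>: "\<beta> \<in> pos_roots_B n" "\<alpha> = \<beta> \<or> \<alpha> = - \<beta>"
    using assms by (auto simp: long_roots_B_def roots_B_def)
  have "ip n \<beta> \<beta> = 2"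
    using assms \<beta>(2) by (auto simp: long_roots_B_def)
  with \<beta>(1) show thesis
  proof (cases rule: pos_roots_B_cases)
    case (short i)
    then show thesis using \<open>ip n \<beta> \<beta> = 2\<close> by simp
  next
    case (long i j)
    then show thesis using that \<beta>(2) by blast
  qed
qed

text \<open>The Weyl group of type B is transitive on the roots of each length, so an invariant
  \<open>k\<close> has one short and one long value. Explicit reflections between the roots show
  this.\<close>

context
  fixes n :: nat and k :: "vec \<Rightarrow> complex"
  assumes inv: "weyl_invariant n (roots_B n) k"
begin

text \<open>The reflection in \<alpha> sends \<alpha> to its negative.\<close>

lemma k_uminus: "\<alpha> \<in> roots_B n \<Longrightarrow> ip n \<alpha> \<alpha> \<noteq> 0 \<Longrightarrow> k (- \<alpha>) = k \<alpha>"
  by (rule weyl_invariantD[OF inv]) (auto simp: reflection_def fun_eq_iff)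

lemma k_short:
  assumes "\<beta> \<in> short_roots_B n" "i \<in> {1..n}"
  shows "k (std_basis i) = k \<beta>"
proof -
  obtain j where j: "j \<in> {1..n}" "\<beta> = std_basis j \<or> \<beta> = - std_basis j"
    using assms(1) by (rule short_root_B_cases)
  then have "k \<beta> = k (std_basis j)"
    using k_uminus[of "std_basis j"] roots_B_mem(1)[of j n] by auto
  \<comment> \<open>The transposition of \<open>i\<close> and \<open>j\<close> carries e_j to
    e_i.\<close>
  moreover have "k (std_basis i) = k (std_basis j)" if "i \<noteq> j"
    by (rule weyl_invariantD[OF inv, where \<beta> = "std_basis i - std_basis j"])
      (use that assms j in \<open>auto simp: reflection_diff roots_B_mem std_basis_apply fun_eq_iff\<close>)
  ultimately show ?thesis by (cases "i = j") auto
qed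

lemma k_diff_plus:
  assumes "i \<in> {1..n}" "j \<in> {1..n}" "i \<noteq> j"
  shows "k (std_basis i - std_basis j) = k (std_basis i + std_basis j)"
  by (rule weyl_invariantD[OF inv, where \<beta> = "std_basis j"])
    (use assms in \<open>auto simp: reflection_short roots_B_mem std_basis_apply fun_eq_iff\<close>)

lemma k_plus_swap:
  assumes "i \<in> {1..n}" "j \<in> {1..n}" "l \<in> {1..n}" "i \<noteq> j" "i \<noteq> l"
  shows "k (std_basis i + std_basis j) = k (std_basis i + std_basis l)"
proof (cases "j = l")
  case False
  show ?thesis
    by (rule weyl_invariantD[OF inv, where \<beta> = "std_basis j - std_basis l"])
      (use assms False in \<open>auto simp: reflection_diff roots_B_mem std_basis_apply fun_eq_iff\<close>)
qed auto

text \<open>One index is exchanged at a time. If i = q, the intermediate vector e_i + e_q would not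
  be a root, but then a single exchange suffices.\<close>

lemma k_plus_const:
  assumes "i \<in> {1..n}" "j \<in> {1..n}" "i \<noteq> j" "p \<in> {1..n}" "q \<in> {1..n}" "p \<noteq> q"
  shows "k (std_basis i + std_basis j) = k (std_basis p + std_basis q)"
proof (cases "i = q")
  case True
  then show ?thesis
    using k_plus_swap[of i j p] assms by (simp add: add.commute)
next
  case False
  then show ?thesis
    using k_plus_swap[of i j q] k_plus_swap[of q i p] assms by (simp add: add.commute)
qed

lemma k_long:
  assumes "\<alpha> \<in> long_roots_B n" "i \<in> {1..n}" "j \<in> {1..n}" "i \<noteq> j"
  shows "k (std_basis i + std_basis j) = k \<alpha>" "k (std_basis i - std_basis j) = k \<alpha>"
proof -
  obtain \<beta> p q where pq: "p \<in> {1..n}" "q \<in> {1..n}" "p \<noteq> q" "\<alpha> = \<beta> \<or> \<alpha> = - \<beta>"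
    "\<beta> = std_basis p - std_basis q \<or> \<beta> = std_basis p + std_basis q"
    using assms(1) by (rule long_root_B_cases)
  have "ip n \<beta> \<beta> \<noteq> 0" "\<beta> \<in> roots_B n"
    using pq(5) ip_long[OF pq(1-3)] roots_B_mem(2,3)[of p n q] pq(1-3) by auto
  then have "k \<alpha> = k \<beta>"
    using pq(4) k_uminus by auto
  also have "k \<beta> = k (std_basis p + std_basis q)"
    using pq(5) k_diff_plus[OF pq(1-3)] by auto
  finally have "k \<alpha> = k (std_basis p + std_basis q)" .
  then show "k (std_basis i + std_basis j) = k \<alpha>" "k (std_basis i - std_basis j) = k \<alpha>"
    using k_plus_const[of i j p q] k_diff_plus[of i j] assms pq by auto
qed

end

section \<open>The Clifford algebra is nonzero\<close>

text \<open>Serves twice: it extends a representation from words to polynomials, and it yields the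
  functional that separates a pure tensor from the tensor relations.\<close>

definition lin_ext :: "('a \<Rightarrow> complex) \<Rightarrow> ('a \<Rightarrow>\<^sub>0 complex) \<Rightarrow> complex" where
  "lin_ext g p = (\<Sum>k\<in>Poly_Mapping.keys p. Poly_Mapping.lookup p k * g k)"

text \<open>Cancellation can shrink the support of a sum; summing over a common superset makes
  additivity accessible.\<close>

lemma lin_ext_superset:
  assumes "finite K" "Poly_Mapping.keys p \<subseteq> K"
  shows "lin_ext g p = (\<Sum>k\<in>K. Poly_Mapping.lookup p k * g k)"
  unfolding lin_ext_def using assms by (intro sum.mono_neutral_left) (auto simp: in_keys_iff)

lemma lin_ext_zero [simp]: "lin_ext g 0 = 0"
  by (simp add: lin_ext_def)

lemma lin_ext_single [simp]: "lin_ext g (Poly_Mapping.single k a) = a * g k"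
  by (subst lin_ext_superset[of "{k}"]) (auto simp: lookup_single)

lemma lin_ext_add: "lin_ext g (p + q) = lin_ext g p + lin_ext g q"
proof -
  let ?K = "Poly_Mapping.keys p \<union> Poly_Mapping.keys q"
  have "Poly_Mapping.keys (p + q) \<subseteq> ?K" by (rule Poly_Mapping.keys_add)
  then show ?thesis
    by (subst (1 2 3) lin_ext_superset[of ?K]) (auto simp: lookup_add distrib_right sum.distrib)
qed

lemma lin_ext_uminus: "lin_ext g (- p) = - lin_ext g p"
  using lin_ext_add[of g p "- p"] by (simp add: eq_neg_iff_add_eq_0 add.commute)

lemma lin_ext_diff: "lin_ext g (p - q) = lin_ext g p - lin_ext g q"
  using lin_ext_add[of g p "- q"] by (simp add: lin_ext_uminus)

section \<open>Representations of the free algebra on function spaces\<close>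

definition free_rep ::
  "('g \<Rightarrow> ('s \<Rightarrow> complex) \<Rightarrow> 's \<Rightarrow> complex) \<Rightarrow> 'g free \<Rightarrow> ('s \<Rightarrow> complex) \<Rightarrow> 's \<Rightarrow> complex" where
  "free_rep r p f s = lin_ext (\<lambda>w. foldr r (letters w) f s) p"

locale linear_operators =
  fixes r :: "'g \<Rightarrow> ('s \<Rightarrow> complex) \<Rightarrow> 's \<Rightarrow> complex"
  assumes r_add: "r g (\<lambda>s. f s + f' s) = (\<lambda>s. r g f s + r g f' s)"
    and r_scale: "r g (\<lambda>s. a * f s) = (\<lambda>s. a * r g f s)"
begin

lemma foldr_add: "foldr r gs (\<lambda>s. f s + f' s) = (\<lambda>s. foldr r gs f s + foldr r gs f' s)"
  by (induction gs) (auto simp: r_add)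

lemma foldr_scale: "foldr r gs (\<lambda>s. a * f s) = (\<lambda>s. a * foldr r gs f s)"
  by (induction gs) (auto simp: r_scale)

lemma rep_add: "free_rep r (p + q) f s = free_rep r p f s + free_rep r q f s"
  by (simp add: free_rep_def lin_ext_add)

lemma rep_single: "free_rep r (Poly_Mapping.single w a) f s = a * foldr r (letters w) f s"
  by (simp add: free_rep_def)

lemma rep_zero [simp]: "free_rep r 0 f s = 0"
  by (simp add: free_rep_def)

lemma rep_one [simp]: "free_rep r 1 f = f"
  by (rule ext) (simp add: rep_single zero_word_def flip: single_one)

lemma rep_gen [simp]: "free_rep r (gen_of g) f = r g f"
  by (rule ext) (simp add: gen_of_def rep_single)

text \<open>Concatenation of words is composition of operators, which settles two monomials;
  induction on the right factor extends this, and \<open>rep_mult\<close> then treats the left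
  factor.\<close>

lemma rep_single_mult:
  "free_rep r (Poly_Mapping.single w a * q) f s = a * foldr r (letters w) (free_rep r q f) s"
proof -
  have "Poly_Mapping.keys q \<subseteq> UNIV" by simp
  then show ?thesis
  proof (induction q rule: poly_mapping_add_induct)
    case zero
    show ?case
      using foldr_scale[of "letters w" 0 "\<lambda>_. 0"] by (simp add: fun_eq_iff free_rep_def)
  next
    case (single k b)
    have "free_rep r (Poly_Mapping.single k b) f = (\<lambda>s. b * foldr r (letters k) f s)"
      by (rule ext) (simp add: rep_single)
    then show ?case
      by (simp add: mult_single rep_single plus_word_def foldr_scale)
  next
    case (add p q)
    have "free_rep r (p + q) f = (\<lambda>s. free_rep r p f s + free_rep r q f s)"
      by (rule ext) (simp add: rep_add)
    then show ?case
      using add.IH by (simp add: distrib_left rep_add foldr_add)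
  qed
qed

lemma rep_mult: "free_rep r (p * q) f = free_rep r p (free_rep r q f)"
proof -
  have "Poly_Mapping.keys p \<subseteq> UNIV" by simp
  then show ?thesis
  proof (induction p rule: poly_mapping_add_induct)
    case (single k a)
    show ?case by (rule ext) (simp add: rep_single_mult rep_single)
  next
    case (add p p')
    then show ?case by (intro ext) (simp add: distrib_right rep_add)
  qed (simp add: fun_eq_iff)
qed

lemma rep_of_zero: "free_rep r p (\<lambda>_. 0) = (\<lambda>_. 0)"
proof
  fix s
  have "foldr r gs (\<lambda>_. 0) = (\<lambda>_. 0)" for gs
    using foldr_scale[of gs 0 "\<lambda>_. 0"] by simp
  then show "free_rep r p (\<lambda>_. 0) s = 0"
    by (simp add: free_rep_def lin_ext_def)
qed

text \<open>The polynomials acting as zero form an ideal containing the relations, whereas 1 acts as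
  the identity and so fixes the constant function 1.\<close>

lemma one_notin_genideal:
  assumes R: "R \<subseteq> carrier (free_algebra A)" and zero: "\<And>p f. p \<in> R \<Longrightarrow> free_rep r p f = (\<lambda>_. 0)"
  shows "1 \<notin> genideal (free_algebra A) R"
proof -
  let ?J = "{p \<in> carrier (free_algebra A). \<forall>f. free_rep r p f = (\<lambda>_. 0)}"
  interpret F: complex_space "free_algebra A"
    by (simp add: complex_space_def module_free_algebra)
  have "submodule ?J complex_ring (free_algebra A)"
    by (rule F.subspaceI) (auto intro!: ext simp: rep_mult rep_of_zero rep_add)
  then have "ideal ?J (free_algebra A)"
    by (intro idealI ring_free_algebra) (auto simp: rep_mult rep_of_zero submodule_def)
  then have "genideal (free_algebra A) R \<subseteq> ?J"
    using R zero by (intro ring.genideal_minimal ring_free_algebra) auto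
  moreover have "1 \<notin> ?J"
    using fun_cong[of "\<lambda>_. 1" "\<lambda>_. 0 :: complex"] by auto
  ultimately show ?thesis by blast
qed

end

text \<open>
  Left multiplication by \<open>c\<^sub>i\<close> in the monomial basis of the Clifford algebra, in which the
  monomial with index set \<open>S\<close> has its factors in increasing order.
\<close>

definition clifford_sign :: "nat \<Rightarrow> nat set \<Rightarrow> complex" where
  "clifford_sign i S = (if i \<in> S then 1 else - 1) * (\<Prod>l<i. if l \<in> S then - 1 else 1)"

definition toggle :: "nat \<Rightarrow> nat set \<Rightarrow> nat set" where
  "toggle i S = (if i \<in> S then S - {i} else insert i S)"

text \<open>A function records coefficients, so its new value at \<open>S\<close> comes from the
  monomial of \<open>toggle i S\<close>. If \<open>i\<close> is not in \<open>S\<close>, two factors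
  c_i meet and their square -1 gives the extra sign in \<open>clifford_sign\<close>.\<close>

fun clifford_op :: "generator \<Rightarrow> (nat set \<Rightarrow> complex) \<Rightarrow> nat set \<Rightarrow> complex" where
  "clifford_op (Cgen i) f S = clifford_sign i S * f (toggle i S)"
| "clifford_op g f S = 0"

lemma mem_toggle: "l \<in> toggle i S \<longleftrightarrow> (if l = i then l \<notin> S else l \<in> S)"
  by (auto simp: toggle_def)

lemma toggle_toggle [simp]: "toggle i (toggle i S) = S"
  by (auto simp: toggle_def)

lemma toggle_commute: "toggle i (toggle j S) = toggle j (toggle i S)"
  by (auto simp: mem_toggle)

text \<open>Toggling \<open>j\<close> below \<open>i\<close> flips one factor of the product,
  toggling \<open>i\<close> flips the leading sign, and toggling above \<open>i\<close> changes
  nothing. For distinct indices exactly one order of the two operators picks up a sign, hence they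
  anticommute.\<close>

lemma clifford_sign_toggle:
  "clifford_sign i (toggle j S) = (if j \<le> i then - clifford_sign i S else clifford_sign i S)"
proof -
  let ?e = "\<lambda>S l. if l \<in> S then - 1 else (1::complex)"
  have split: "prod (?e T) {..<i} = ?e T j * prod (?e T) ({..<i} - {j})" if "j < i" for T
    using that by (intro prod.remove) auto
  have eq: "prod (?e (toggle j S)) (B - {j}) = prod (?e S) (B - {j})" for B
    by (rule prod.cong) (auto simp: mem_toggle)
  consider "j < i" | "j = i" | "i < j" by linarith
  then show ?thesis
  proof cases
    case 1
    then show ?thesis
      unfolding clifford_sign_def split[OF 1] eq by (auto simp: mem_toggle)
  next
    case 2
    then show ?thesis
      using eq[of "{..<i}"] by (simp add: clifford_sign_def mem_toggle)
  next
    case 3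
    then show ?thesis
      using eq[of "{..<i}"] by (simp add: clifford_sign_def mem_toggle)
  qed
qed

lemma clifford_sign_square: "clifford_sign i S * clifford_sign i S = 1"
proof -
  have "(\<Prod>l<i. if l \<in> S then - 1 else 1) * (\<Prod>l<i. if l \<in> S then - 1 else (1::complex)) = 1"
    by (simp add: prod.distrib[symmetric] if_distrib cong: if_cong)
  then show ?thesis by (simp add: clifford_sign_def)
qed

text \<open>The Clifford relations act as zero in the monomial representation, so 1 lies outside
  their ideal and its class is nonzero.\<close>

lemma clifford_nonzero: "carrier (clifford n) \<noteq> {\<zero>\<^bsub>clifford n\<^esub>}"
proof -
  interpret linear_operators clifford_op
  proof
    fix g f f' a
    show "clifford_op g (\<lambda>s. f s + f' s) = (\<lambda>s. clifford_op g f s + clifford_op g f' s)"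
      by (cases g) (auto simp: distrib_left)
    show "clifford_op g (\<lambda>s. a * f s) = (\<lambda>s. a * clifford_op g f s)"
      by (cases g) auto
  qed
  interpret presentation "Cgen ` {1..n}" "clifford_rels n"
    by (rule presentation_clifford)
  have anti: "free_rep clifford_op (cc i * cc j + cc j * cc i) f = (\<lambda>_. 0)" if "i \<noteq> j" for i j f
    using that by (intro ext)
      (auto simp: rep_add rep_mult clifford_sign_toggle toggle_commute[of i j])
  have sq: "free_rep clifford_op (cc i * cc i + 1) f = (\<lambda>_. 0)" for i f
    by (intro ext) (simp add: rep_add rep_mult clifford_sign_toggle clifford_sign_square flip: mult.assoc)
  have "1 \<notin> rel_ideal"
    by (rule one_notin_genideal[OF rels]) (auto simp: clifford_rels_def anti sq)
  then have "cls 1 \<noteq> \<zero>\<^bsub>clifford n\<^esub>" "cls 1 \<in> carrier (clifford n)"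
    using cls_zero_iff[of 1] cls_mem[of 1] by (auto simp: clifford_def)
  then show ?thesis by auto
qed

section \<open>Tensor products\<close>

text \<open>Such functionals detect nonzero vectors; a pair of them will show that a pure tensor of
  nonzero vectors is nonzero.\<close>

lemma (in complex_space) functional_exists:
  assumes u: "u \<in> carrier V" "u \<noteq> \<zero>"
  obtains l :: "'v \<Rightarrow> complex" where "l u = 1"
    "\<And>v w. \<lbrakk>v \<in> carrier V; w \<in> carrier V\<rbrakk> \<Longrightarrow> l (v \<oplus> w) = l v + l w"
    "\<And>a v. v \<in> carrier V \<Longrightarrow> l (a \<odot> v) = a * l v"
proof -
  \<comment> \<open>A subspace that is maximal among those not containing \<open>u\<close> is a complement of the line of \<open>u\<close>.\<close>
  let ?S = "{M. submodule M complex_ring V \<and> u \<notin> M}"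
  have "\<exists>M\<in>?S. \<forall>T\<in>?S. M \<subseteq> T \<longrightarrow> T = M"
  proof (rule subset_Zorn_nonempty)
    have "submodule {\<zero>} complex_ring V"
      by (rule subspaceI) auto
    then show "?S \<noteq> {}" using u by auto
  next
    fix C assume C: "C \<noteq> {}" "subset.chain ?S C"
    then have sub: "submodule T complex_ring V" "u \<notin> T" if "T \<in> C" for T
      using that by (auto simp: subset_chain_def)
    have "submodule (\<Union>C) complex_ring V"
    proof (rule subspaceI)
      show "\<Union>C \<subseteq> carrier V" using subspaceD(1)[OF sub(1)] by blast
      show "\<zero> \<in> \<Union>C" using C(1) subspaceD(2)[OF sub(1)] by blast
      show "a \<odot> v \<in> \<Union>C" if "v \<in> \<Union>C" for a v
        using that subspaceD(4)[OF sub(1)] by blast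
      fix v w assume "v \<in> \<Union>C" "w \<in> \<Union>C"
      then obtain T Y where XY: "T \<in> C" "Y \<in> C" "v \<in> T" "w \<in> Y" by blast
      then have "T \<subseteq> Y \<or> Y \<subseteq> T"
        using C(2) by (auto simp: subset_chain_def)
      then obtain Z where "Z \<in> C" "v \<in> Z" "w \<in> Z"
        using XY by blast
      then show "v \<oplus> w \<in> \<Union>C"
        using subspaceD(3)[OF sub(1)] by blast
    qed
    then show "\<Union>C \<in> ?S" using sub(2) by blast
  qed
  then obtain M where M: "submodule M complex_ring V" "u \<notin> M"
    and max: "\<And>T. \<lbrakk>submodule T complex_ring V; u \<notin> T; M \<subseteq> T\<rbrakk> \<Longrightarrow> T = M"
    by auto
  note D = subspaceD[OF M(1)]
  \<comment> \<open>\<open>P v a\<close> says that \<open>a\<close> is the coordinate of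
    \<open>v\<close> along \<open>u\<close> modulo \<open>M\<close>.\<close>
  define P where "P v a \<longleftrightarrow> v \<oplus> (- a) \<odot> u \<in> M" for v a
  have zero: "c = 0" if "c \<odot> u \<in> M" for c
  proof (rule ccontr)
    assume "c \<noteq> 0"
    then have "u = inverse c \<odot> (c \<odot> u)"
      using u(1) by (simp add: smult_smult)
    then show False using D(4)[OF that, of "inverse c"] M(2) by simp
  qed
  have P_ex: "\<exists>a. P v a" if v: "v \<in> carrier V" for v
  proof (cases "v \<in> M")
    case True
    then have "P v 0" using u v by (simp add: P_def)
    then show ?thesis ..
  next
    case False
    \<comment> \<open>The span of \<open>M\<close> and \<open>v\<close> is strictly larger than
      \<open>M\<close>, so by maximality it contains \<open>u\<close>. Solving u = m + b v for
      \<open>v\<close> gives the coordinate 1/b.\<close>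
    define N where "N = {m \<oplus> b \<odot> v | m b. m \<in> M}"
    have "submodule N complex_ring V"
    proof (rule subspaceI)
      show "N \<subseteq> carrier V" using D(1) v by (auto simp: N_def)
      show "\<zero> \<in> N" unfolding N_def using D(2) v by (intro CollectI exI[of _ \<zero>] exI[of _ 0]) auto
      show "a \<odot> x \<in> N" if "x \<in> N" for a x
      proof -
        obtain m b where m: "m \<in> M" "x = m \<oplus> b \<odot> v"
          using \<open>x \<in> N\<close> unfolding N_def by blast
        then have "a \<odot> x = a \<odot> m \<oplus> (a * b) \<odot> v"
          using D(1) v by (auto simp: smult_add smult_smult)
        then show ?thesis unfolding N_def using m D(4) by blast
      qed
      show "x \<oplus> y \<in> N" if "x \<in> N" "y \<in> N" for x y
      proof -
        obtain m b m' b' where m: "m \<in> M" "x = m \<oplus> b \<odot> v" "m' \<in> M" "y = m' \<oplus> b' \<odot> v"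
          using \<open>x \<in> N\<close> \<open>y \<in> N\<close> unfolding N_def by blast
        then have "m \<in> carrier V" "m' \<in> carrier V" using D(1) by auto
        then have "x \<oplus> y = (m \<oplus> m') \<oplus> (b + b') \<odot> v"
          using m v by (simp add: add_smult M.a_ac)
        then show ?thesis unfolding N_def using m D(3) by blast
      qed
    qed
    moreover have "M \<subseteq> N"
    proof
      fix m assume "m \<in> M"
      then show "m \<in> N" unfolding N_def
        using D(1) v by (intro CollectI exI[of _ m] exI[of _ 0]) auto
    qed
    moreover have "v \<in> N"
      unfolding N_def using D(2) v by (intro CollectI exI[of _ \<zero>] exI[of _ 1]) auto
    ultimately have "u \<in> N" using max[of N] False by blast
    then obtain m b where m: "m \<in> M" "u = m \<oplus> b \<odot> v" unfolding N_def by blast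
    then have mc: "m \<in> carrier V" using D(1) by auto
    \<comment> \<open>If \<open>b\<close> were 0, then \<open>u\<close> would equal \<open>m\<close>
      and lie in \<open>M\<close>.\<close>
    then have b: "b \<noteq> 0" using m M(2) v by auto
    have "v \<oplus> (- inverse b) \<odot> u = (- inverse b) \<odot> m"
    proof -
      have "(- inverse b) \<odot> u = (- inverse b) \<odot> m \<oplus> (- 1) \<odot> v"
        using m(2) mc v b by (simp add: smult_add smult_smult)
      also have "v \<oplus> \<dots> = (- inverse b) \<odot> m \<oplus> (v \<oplus> \<ominus> v)"
        using mc v by (simp only: minus_one_smult M.a_lcomm M.a_inv_closed smult_mem)
      finally show ?thesis using mc v by (simp add: M.r_neg)
    qed
    then have "P v (inverse b)" using m(1) D(4) by (simp add: P_def)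
    then show ?thesis ..
  qed
  have P_unique: "a = b" if v: "v \<in> carrier V" and ab: "P v a" "P v b" for v a b
  proof -
    have "(v \<oplus> (- a) \<odot> u) \<oplus> (- 1) \<odot> (v \<oplus> (- b) \<odot> u) \<in> M"
      using ab D(3,4) by (simp add: P_def)
    also have "(- 1) \<odot> (v \<oplus> (- b) \<odot> u) = \<ominus> v \<oplus> b \<odot> u"
      using u v by (simp add: smult_add smult_smult minus_one_smult)
    also have "(v \<oplus> (- a) \<odot> u) \<oplus> (\<ominus> v \<oplus> b \<odot> u) = (v \<oplus> \<ominus> v) \<oplus> ((- a) \<odot> u \<oplus> b \<odot> u)"
      using u v by (simp add: M.a_ac)
    also have "\<dots> = (b - a) \<odot> u"
      using u v add_smult[of u "- a" b] by (simp add: M.r_neg)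
    finally show ?thesis using zero[of "b - a"] by simp
  qed
  define l where "l v = (SOME a. P v a)" for v
  have l: "P v (l v)" if "v \<in> carrier V" for v
    unfolding l_def using P_ex[OF that] by (rule someI_ex)
  have l_eq: "l v = a" if "v \<in> carrier V" "P v a" for v a
    using P_unique[OF that(1) l[OF that(1)] that(2)] .
  show thesis
  proof
    have "P u 1" using u D(2) by (simp add: P_def minus_one_smult M.r_neg)
    then show "l u = 1" using l_eq u by blast
  next
    fix v w assume vw: "v \<in> carrier V" "w \<in> carrier V"
    have "(v \<oplus> (- l v) \<odot> u) \<oplus> (w \<oplus> (- l w) \<odot> u) \<in> M"
      using l[OF vw(1)] l[OF vw(2)] D(3) by (simp add: P_def)
    also have "(v \<oplus> (- l v) \<odot> u) \<oplus> (w \<oplus> (- l w) \<odot> u)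
        = (v \<oplus> w) \<oplus> ((- l v) \<odot> u \<oplus> (- l w) \<odot> u)"
      using u vw by (simp add: M.a_ac)
    also have "\<dots> = (v \<oplus> w) \<oplus> (- (l v + l w)) \<odot> u"
      using u add_smult[of u "- l v" "- l w"] by simp
    finally show "l (v \<oplus> w) = l v + l w"
      using vw by (intro l_eq) (auto simp: P_def)
  next
    fix a v assume v: "v \<in> carrier V"
    have "a \<odot> (v \<oplus> (- l v) \<odot> u) \<in> M"
      using l[OF v] D(4) by (simp add: P_def)
    also have "a \<odot> (v \<oplus> (- l v) \<odot> u) = a \<odot> v \<oplus> (- (a * l v)) \<odot> u"
      using u v by (simp add: smult_add smult_smult)
    finally show "l (a \<odot> v) = a * l v"
      using v by (intro l_eq) (auto simp: P_def)
  qed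
qed

section \<open>Formal linear combinations\<close>

lemma free_space_simps [simp]:
  "\<zero>\<^bsub>free_space B\<^esub> = 0" "p \<oplus>\<^bsub>free_space B\<^esub> q = p + q"
  "a \<odot>\<^bsub>free_space B\<^esub> p = Poly_Mapping.map ((*) a) p"
  by (simp_all add: free_space_def)

lemma free_space_carrier: "p \<in> carrier (free_space B) \<longleftrightarrow> Poly_Mapping.keys p \<subseteq> B"
  by (simp add: free_space_def)

lemma lookup_map_times [simp]:
  "Poly_Mapping.lookup (Poly_Mapping.map ((*) a) p) k = a * Poly_Mapping.lookup p k"
  for a :: complex
  by (simp add: Poly_Mapping.map.rep_eq when_def)

lemma map_times_single [simp]:
  "Poly_Mapping.map ((*) a) (Poly_Mapping.single k b) = Poly_Mapping.single k (a * b)"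
  for a :: complex
  by (rule poly_mapping_eqI) (simp add: lookup_single when_def)

lemma free_space_closed [simp, intro]:
  "0 \<in> carrier (free_space B)"
  "k \<in> B \<Longrightarrow> Poly_Mapping.single k a \<in> carrier (free_space B)"
  "\<lbrakk>p \<in> carrier (free_space B); q \<in> carrier (free_space B)\<rbrakk> \<Longrightarrow> p + q \<in> carrier (free_space B)"
  "p \<in> carrier (free_space B) \<Longrightarrow> - p \<in> carrier (free_space B)"
  "\<lbrakk>p \<in> carrier (free_space B); q \<in> carrier (free_space B)\<rbrakk> \<Longrightarrow> p - q \<in> carrier (free_space B)"
  "p \<in> carrier (free_space B) \<Longrightarrow> Poly_Mapping.map ((*) a) p \<in> carrier (free_space B)"
proof -
  show "p - q \<in> carrier (free_space B)" if "p \<in> carrier (free_space B)" "q \<in> carrier (free_space B)"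
    using that Poly_Mapping.keys_add[of p "- q"] by (auto simp: free_space_carrier)
  show "p + q \<in> carrier (free_space B)" if "p \<in> carrier (free_space B)" "q \<in> carrier (free_space B)"
    using that Poly_Mapping.keys_add[of p q] by (auto simp: free_space_carrier)
qed (auto simp: free_space_carrier in_keys_iff)

lemma complex_space_free_space: "complex_space (free_space B)"
  unfolding complex_space_def
proof (rule module_complexI)
  show "abelian_group (free_space B)"
  proof (rule abelian_groupI)
    fix p assume "p \<in> carrier (free_space B)"
    then show "\<exists>q\<in>carrier (free_space B). q \<oplus>\<^bsub>free_space B\<^esub> p = \<zero>\<^bsub>free_space B\<^esub>"
      by (intro bexI[of _ "- p"]) auto
  qed (auto simp: add.assoc add.commute)
qed (auto intro!: poly_mapping_eqI simp: lookup_add algebra_simps)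

lemma free_space_minus:
  assumes "p \<in> carrier (free_space B)" "q \<in> carrier (free_space B)"
  shows "p \<ominus>\<^bsub>free_space B\<^esub> q = p - q"
proof -
  interpret F: complex_space "free_space B"
    by (rule complex_space_free_space)
  show ?thesis
    using F.M.minus_equality[of "- q" q] assms by (simp add: a_minus_def)
qed

lemma lin_ext_map_times: "lin_ext g (Poly_Mapping.map ((*) a) p) = a * lin_ext g p"
proof -
  have "lin_ext g (Poly_Mapping.map ((*) a) p)
      = (\<Sum>k\<in>Poly_Mapping.keys p. Poly_Mapping.lookup (Poly_Mapping.map ((*) a) p) k * g k)"
    by (rule lin_ext_superset) (auto simp: in_keys_iff)
  then show ?thesis
    by (simp add: lin_ext_def sum_distrib_left mult.assoc)
qed

section \<open>The tensor product and its pure tensors\<close>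

locale tensor_space = U: complex_space U + V: complex_space V
  for U :: "(complex, 'u) module" and V :: "(complex, 'v) module"
begin

abbreviation F where "F \<equiv> free_space (carrier U \<times> carrier V)"

abbreviation pt where "pt \<equiv> pure_tensor U V"

sublocale F: complex_space F
  by (rule complex_space_free_space)

lemma tensor_rels_carrier: "tensor_rels U V \<subseteq> carrier F"
  unfolding tensor_rels_def Let_def
  by (auto intro!: free_space_closed)

lemmas tensor_ker_subspace = F.lin_span_subspace(1)[OF tensor_rels_carrier, folded tensor_ker_def]

lemma tensor_rel_mem: "p \<in> tensor_rels U V \<Longrightarrow> p \<in> tensor_ker U V"
  unfolding tensor_ker_def using F.lin_span_subspace(2)[OF tensor_rels_carrier] by blast

definition coset where "coset p = tensor_ker U V +>\<^bsub>F\<^esub> p"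

lemma coset_add: "\<lbrakk>p \<in> carrier F; q \<in> carrier F\<rbrakk> \<Longrightarrow> coset p \<oplus>\<^bsub>tensor U V\<^esub> coset q = coset (p + q)"
  using F.quot_add[OF tensor_ker_subspace] by (simp add: coset_def tensor_def)

lemma coset_smult: "p \<in> carrier F \<Longrightarrow> a \<odot>\<^bsub>tensor U V\<^esub> coset p = coset (Poly_Mapping.map ((*) a) p)"
  using F.quot_smult[OF tensor_ker_subspace] by (simp add: coset_def tensor_def)

lemma coset_cong: "\<lbrakk>p \<in> carrier F; q \<in> carrier F; p - q \<in> tensor_ker U V\<rbrakk> \<Longrightarrow> coset p = coset q"
  unfolding coset_def by (rule F.quot_coset_cong[OF tensor_ker_subspace]) (auto simp: free_space_minus)

lemma coset_zero: "coset 0 = \<zero>\<^bsub>tensor U V\<^esub>"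
  using F.quot_coset_eq_iff[OF tensor_ker_subspace, of 0] F.subspaceD(2)[OF tensor_ker_subspace]
  by (simp add: coset_def tensor_def F.quot_zero)

lemma tensor_carrier: "carrier (tensor U V) = coset ` carrier F"
  by (simp add: tensor_def F.quot_carrier coset_def)

lemma pt_coset: "pt u v = coset (Poly_Mapping.single (u, v) 1)"
  by (simp add: pure_tensor_def coset_def)

lemma pt_mem [simp, intro]: "\<lbrakk>u \<in> carrier U; v \<in> carrier V\<rbrakk> \<Longrightarrow> pt u v \<in> carrier (tensor U V)"
  by (auto simp: tensor_carrier pt_coset)

lemma pt_add_left:
  assumes "u \<in> carrier U" "u' \<in> carrier U" "v \<in> carrier V"
  shows "pt (u \<oplus>\<^bsub>U\<^esub> u') v = pt u v \<oplus>\<^bsub>tensor U V\<^esub> pt u' v"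
proof -
  let ?t = "\<lambda>u. Poly_Mapping.single (u, v) (1 :: complex)"
  have "?t (u \<oplus>\<^bsub>U\<^esub> u') - ?t u - ?t u' \<in> tensor_ker U V"
    using assms by (intro tensor_rel_mem) (auto simp: tensor_rels_def Let_def)
  then have "coset (?t (u \<oplus>\<^bsub>U\<^esub> u')) = coset (?t u + ?t u')"
    using assms by (intro coset_cong) (auto simp: algebra_simps)
  then show ?thesis
    using assms by (simp add: pt_coset coset_add)
qed

lemma pt_add_right:
  assumes "u \<in> carrier U" "v \<in> carrier V" "v' \<in> carrier V"
  shows "pt u (v \<oplus>\<^bsub>V\<^esub> v') = pt u v \<oplus>\<^bsub>tensor U V\<^esub> pt u v'"
proof -
  let ?t = "\<lambda>v. Poly_Mapping.single (u, v) (1 :: complex)"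
  have "?t (v \<oplus>\<^bsub>V\<^esub> v') - ?t v - ?t v' \<in> tensor_ker U V"
    using assms by (intro tensor_rel_mem) (auto simp: tensor_rels_def Let_def)
  then have "coset (?t (v \<oplus>\<^bsub>V\<^esub> v')) = coset (?t v + ?t v')"
    using assms by (intro coset_cong) (auto simp: algebra_simps)
  then show ?thesis
    using assms by (simp add: pt_coset coset_add)
qed

lemma pt_smult_left:
  assumes "u \<in> carrier U" "v \<in> carrier V"
  shows "pt (a \<odot>\<^bsub>U\<^esub> u) v = a \<odot>\<^bsub>tensor U V\<^esub> pt u v"
proof -
  have "Poly_Mapping.single (a \<odot>\<^bsub>U\<^esub> u, v) 1 - Poly_Mapping.single (u, v) a \<in> tensor_ker U V"
    using assms by (intro tensor_rel_mem) (auto simp: tensor_rels_def Let_def)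
  then have "coset (Poly_Mapping.single (a \<odot>\<^bsub>U\<^esub> u, v) 1) = coset (Poly_Mapping.single (u, v) a)"
    using assms by (intro coset_cong) auto
  then show ?thesis
    using assms by (simp add: pt_coset coset_smult)
qed

lemma pt_smult_right:
  assumes "u \<in> carrier U" "v \<in> carrier V"
  shows "pt u (a \<odot>\<^bsub>V\<^esub> v) = a \<odot>\<^bsub>tensor U V\<^esub> pt u v"
proof -
  have "Poly_Mapping.single (u, a \<odot>\<^bsub>V\<^esub> v) 1 - Poly_Mapping.single (u, v) a \<in> tensor_ker U V"
    using assms by (intro tensor_rel_mem) (auto simp: tensor_rels_def Let_def)
  then have "coset (Poly_Mapping.single (u, a \<odot>\<^bsub>V\<^esub> v) 1) = coset (Poly_Mapping.single (u, v) a)"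
    using assms by (intro coset_cong) auto
  then show ?thesis
    using assms by (simp add: pt_coset coset_smult)
qed

text \<open>Every formal combination is a sum of multiples of pairs. The rule is used to pass from
  the vanishing of the Dirac element on pure tensors to the whole module.\<close>

lemma tensor_spanned:
  assumes pt: "\<And>u v. \<lbrakk>u \<in> carrier U; v \<in> carrier V\<rbrakk> \<Longrightarrow> pt u v \<in> S"
    and zero: "\<zero>\<^bsub>tensor U V\<^esub> \<in> S"
    and add: "\<And>s t. \<lbrakk>s \<in> S; t \<in> S\<rbrakk> \<Longrightarrow> s \<oplus>\<^bsub>tensor U V\<^esub> t \<in> S"
    and smult: "\<And>a t. t \<in> S \<Longrightarrow> a \<odot>\<^bsub>tensor U V\<^esub> t \<in> S"
  shows "carrier (tensor U V) \<subseteq> S"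
proof -
  have "coset p \<in> S" if "Poly_Mapping.keys p \<subseteq> carrier U \<times> carrier V" for p
    using that
  proof (induction p rule: poly_mapping_add_induct)
    case zero
    then show ?case using assms(2) by (simp add: coset_zero)
  next
    case (single k a)
    obtain u v where "k = (u, v)" "u \<in> carrier U" "v \<in> carrier V"
      using single by auto
    then show ?case
      using smult[OF pt[of u v], of a] by (simp add: pt_coset coset_smult)
  next
    case (add p q)
    then show ?case
      using assms(3)[OF add.IH] by (simp add: coset_add free_space_carrier)
  qed
  then show ?thesis by (auto simp: tensor_carrier free_space_carrier)
qed

text \<open>Choose functionals \<open>l\<close> and \<open>m\<close> with value 1 at nonzero
  \<open>u\<close> and \<open>v\<close>. The linear extension of their product kills all tensor
  relations, hence \<open>tensor_ker\<close>, but is 1 on the pair (u, v).\<close>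

lemma tensor_nonzero:
  assumes "carrier U \<noteq> {\<zero>\<^bsub>U\<^esub>}" "carrier V \<noteq> {\<zero>\<^bsub>V\<^esub>}"
  shows "carrier (tensor U V) \<noteq> {\<zero>\<^bsub>tensor U V\<^esub>}"
proof -
  obtain u v where u: "u \<in> carrier U" "u \<noteq> \<zero>\<^bsub>U\<^esub>" and v: "v \<in> carrier V" "v \<noteq> \<zero>\<^bsub>V\<^esub>"
    using assms U.M.zero_closed V.M.zero_closed by blast
  obtain l where l: "l u = 1" "\<And>x y. \<lbrakk>x \<in> carrier U; y \<in> carrier U\<rbrakk> \<Longrightarrow> l (x \<oplus>\<^bsub>U\<^esub> y) = l x + l y"
    "\<And>a x. x \<in> carrier U \<Longrightarrow> l (a \<odot>\<^bsub>U\<^esub> x) = a * l x"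
    by (rule U.functional_exists[OF u]) blast
  obtain m where m: "m v = 1" "\<And>x y. \<lbrakk>x \<in> carrier V; y \<in> carrier V\<rbrakk> \<Longrightarrow> m (x \<oplus>\<^bsub>V\<^esub> y) = m x + m y"
    "\<And>a x. x \<in> carrier V \<Longrightarrow> m (a \<odot>\<^bsub>V\<^esub> x) = a * m x"
    by (rule V.functional_exists[OF v]) blast
  define L where "L = lin_ext (\<lambda>(x, y). l x * m y)"
  let ?K = "{p \<in> carrier F. L p = 0}"
  have "submodule ?K complex_ring F"
    by (rule F.subspaceI) (auto simp: L_def lin_ext_add lin_ext_map_times)
  moreover have "tensor_rels U V \<subseteq> ?K"
  proof -
    have "L p = 0" if "p \<in> tensor_rels U V" for p
      using that l(2,3) m(2,3)
      by (auto simp: tensor_rels_def Let_def L_def lin_ext_diff distrib_left distrib_right)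
    then show ?thesis using tensor_rels_carrier by blast
  qed
  ultimately have "tensor_ker U V \<subseteq> ?K"
    unfolding tensor_ker_def lin_span_def by blast
  moreover have "L (Poly_Mapping.single (u, v) 1) = 1"
    by (simp add: L_def l(1) m(1))
  ultimately have "Poly_Mapping.single (u, v) 1 \<notin> tensor_ker U V"
    by auto
  then have "pt u v \<noteq> \<zero>\<^bsub>tensor U V\<^esub>"
    using u v F.quot_coset_eq_iff[OF tensor_ker_subspace]
    by (simp add: pt_coset coset_def tensor_def F.quot_zero)
  then show ?thesis using u v by auto
qed

end

lemma scal_scal: "scal a * (scal b * p) = scal (a * b) * p"
  by (simp add: scal_mult mult.assoc)

section \<open>Type A\<close>

lemma sqrt2_simps [simp]:
  "sqrt2 * sqrt2 = 2" "sqrt2 * (sqrt2 * a) = 2 * a" "sqrt2 * (a * sqrt2) = 2 * a"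
proof -
  show sq: "sqrt2 * sqrt2 = 2" by (simp flip: of_real_mult)
  show "sqrt2 * (sqrt2 * a) = 2 * a" by (simp flip: mult.assoc add: sq)
  then show "sqrt2 * (a * sqrt2) = 2 * a" by (simp add: mult.commute)
qed

section \<open>Sums over positive roots\<close>

lemma std_basis_pair_inject:
  assumes "j < i" "j' < i'"
  shows "std_basis j - std_basis i = std_basis j' - std_basis i' \<Longrightarrow> i = i' \<and> j = j'"
    "std_basis j + std_basis i = std_basis j' + std_basis i' \<Longrightarrow> i = i' \<and> j = j'"
proof -
  assume eq: "std_basis j - std_basis i = std_basis j' - std_basis i'"
  have "std_basis j l - std_basis i l = std_basis j' l - std_basis i' l" for l
    using fun_cong[OF eq, of l] by simp
  from this[of i] this[of j] show "i = i' \<and> j = j'"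
    using assms by (simp add: std_basis_apply split: if_splits)
next
  assume eq: "std_basis j + std_basis i = std_basis j' + std_basis i'"
  have "std_basis j l + std_basis i l = std_basis j' l + std_basis i' l" for l
    using fun_cong[OF eq, of l] by simp
  \<comment> \<open>A sum of basis vectors only determines the unordered pair; the ordering of the
    indices excludes the swapped one.\<close>
  from this[of i] this[of j] show "i = i' \<and> j = j'"
    using assms by (auto simp: std_basis_apply split: if_splits)
qed

text \<open>The larger index is the outer one, so that the inner sums match the sums over j < i in
  the action of x_i.\<close>

lemma sum_pos_roots_A:
  "sum f (pos_roots_A n) = (\<Sum>i\<in>{1..n}. \<Sum>j\<in>{1..<i}. f (std_basis j - std_basis i))"
proof -
  let ?T = "SIGMA i:{1..n}. {1..<i}"
  have "pos_roots_A n = (\<lambda>(i, j). std_basis j - std_basis i) ` ?T"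
    unfolding pos_roots_A_def by (auto simp: image_iff) (metis atLeastAtMost_iff atLeastLessThan_iff One_nat_def Suc_leI le_trans less_imp_le)
  moreover have "inj_on (\<lambda>(i, j). std_basis j - std_basis i) ?T"
    using std_basis_pair_inject(1) by (intro inj_onI) auto
  ultimately show ?thesis
    by (simp add: sum.reindex sum.Sigma case_prod_unfold)
qed

lemma sum_plus_roots:
  "sum f {std_basis i + std_basis j | i j. 1 \<le> i \<and> i < j \<and> j \<le> n}
    = (\<Sum>i\<in>{1..n}. \<Sum>j\<in>{1..<i}. f (std_basis j + std_basis i))"
proof -
  let ?T = "SIGMA i:{1..n}. {1..<i}"
  have "{std_basis i + std_basis j | i j. 1 \<le> i \<and> i < j \<and> j \<le> n} = (\<lambda>(i, j). std_basis j + std_basis i) ` ?T"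
    by (auto simp: image_iff) (metis atLeastAtMost_iff atLeastLessThan_iff One_nat_def Suc_leI le_trans less_imp_le)
  moreover have "inj_on (\<lambda>(i, j). std_basis j + std_basis i) ?T"
    using std_basis_pair_inject(2) by (intro inj_onI) auto
  ultimately show ?thesis
    by (simp add: sum.reindex sum.Sigma case_prod_unfold)
qed

lemma finite_pos_roots:
  "finite (pos_roots_A n)" "finite {std_basis i + std_basis j | i j. 1 \<le> i \<and> i < j \<and> j \<le> n}"
proof -
  have "pos_roots_A n \<subseteq> (\<lambda>(i, j). std_basis i - std_basis j) ` ({1..n} \<times> {1..n})"
    unfolding pos_roots_A_def by force
  then show "finite (pos_roots_A n)" by (rule finite_subset) auto
  have "{std_basis i + std_basis j | i j. 1 \<le> i \<and> i < j \<and> j \<le> n}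
      \<subseteq> (\<lambda>(i, j). std_basis i + std_basis j) ` ({1..n} \<times> {1..n})"
    by force
  then show "finite {std_basis i + std_basis j | i j. 1 \<le> i \<and> i < j \<and> j \<le> n}"
    by (rule finite_subset) auto
qed

lemma pos_roots_D_eq:
  "pos_roots_D n = pos_roots_A n \<union> {std_basis i + std_basis j | i j. 1 \<le> i \<and> i < j \<and> j \<le> n}"
  by (simp add: pos_roots_D_def pos_roots_A_def)

lemma sum_pos_roots_D:
  "sum f (pos_roots_D n) = (\<Sum>i\<in>{1..n}. \<Sum>j\<in>{1..<i}. f (std_basis j - std_basis i))
    + (\<Sum>i\<in>{1..n}. \<Sum>j\<in>{1..<i}. f (std_basis j + std_basis i))"
proof -
  \<comment> \<open>At coordinate \<open>j\<close> the difference has the value -1, while a sum of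
    basis vectors has no negative coordinate.\<close>
  have neq: "std_basis i - std_basis j \<noteq> std_basis p + std_basis q" if "i < j" for i j p q :: nat
  proof
    assume "std_basis i - std_basis j = std_basis p + std_basis q"
    from fun_cong[OF this, of j] that show False
      by (auto simp: std_basis_apply split: if_splits)
  qed
  have disj: "pos_roots_A n \<inter> {std_basis i + std_basis j | i j. 1 \<le> i \<and> i < j \<and> j \<le> n} = {}"
    unfolding pos_roots_A_def using neq by blast
  show ?thesis
    unfolding pos_roots_D_eq sum.union_disjoint[OF finite_pos_roots disj] sum_pos_roots_A
      sum_plus_roots ..
qed

lemma sum_pos_roots_B: "sum f (pos_roots_B n) = sum f (pos_roots_D n) + (\<Sum>i\<in>{1..n}. f (std_basis i))"
proof -
  have short: "{std_basis i |i. 1 \<le> i \<and> i \<le> n} = std_basis ` {1..n}"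
    by auto
  have "\<alpha> \<noteq> std_basis i" if "\<alpha> \<in> pos_roots_D n" "i \<in> {1..n}" for \<alpha> i
  proof -
    \<comment> \<open>Squared length separates these roots from the short ones.\<close>
    have "ip n \<alpha> \<alpha> = 2"
      using that(1) ip_long unfolding pos_roots_D_def by fastforce
    then show ?thesis using that(2) by auto
  qed
  then have "pos_roots_D n \<inter> std_basis ` {1..n} = {}" by blast
  moreover have "finite (pos_roots_D n)"
    by (simp only: pos_roots_D_eq finite_Un finite_pos_roots)
  ultimately show ?thesis
    unfolding pos_roots_B_def short by (simp add: sum.union_disjoint sum.reindex inj_on_def)
qed

text \<open>The factor sqrt2/2 in front, the squared length 2 and the factor sqrt2/2 in
  \<open>c_root\<close> multiply to 1, leaving just \<open>k\<close> at each root.\<close>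

lemma dirac_A:
  "dirac n (pos_roots_A n) (\<lambda>_. k) = (\<Sum>i\<in>{1..n}. xx i * cc i +
    (\<Sum>j\<in>{1..<i}. scal k * (ww (refl_ij n i j) * (cc j - cc i))))"
proof -
  have "scal (sqrt2 / 2) * (scal (k * complex_of_real (ip n (std_basis j - std_basis i) (std_basis j - std_basis i)))
      * (ww (reflection n (std_basis j - std_basis i)) * c_root n (std_basis j - std_basis i)))
      = scal k * (ww (refl_ij n i j) * (cc j - cc i))" if "i \<in> {1..n}" "j \<in> {1..<i}" for i j
  proof -
    have j: "j \<in> {1..n}" "j \<noteq> i" using that by auto
    show ?thesis
      using ip_long(1)[OF j(1) that(1) j(2)]
      by (simp add: c_root_minus[OF j(1) that(1) j(2)] refl_ij_commute[of n j i] scal_pull[of "ww (refl_ij n i j)"] scal_scal)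
  qed
  then show ?thesis
    unfolding dirac_def sum_pos_roots_A by (simp add: sum_distrib_left sum.distrib)
qed

lemma clifford_rel_mem:
  assumes "presentation A R" "clifford_rels n \<subseteq> R" "i \<in> {1..n}"
  shows "cc i * cc i + 1 \<in> genideal (free_algebra A) R"
    "\<lbrakk>j \<in> {1..n}; i \<noteq> j\<rbrakk> \<Longrightarrow> cc i * cc j + cc j * cc i \<in> genideal (free_algebra A) R"
  using assms by (auto intro!: presentation.rels_rel_ideal simp: clifford_rels_def)

section \<open>The Dirac element on the type A module\<close>

context steinberg_A
begin

interpretation P: presented_module "gens n (weyl n (roots_A n))" "rels_A n k" "clifford n" act
  using presentation_A algebra_module_axioms
  by (simp add: presented_module_def H_A_def)

lemma act_elt_A: "act (elt_A n k p) v = P.op p v"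
  by (simp add: elt_A_def P.op_def)

lemma refl_ij_mem: "\<lbrakk>i \<in> {1..n}; j \<in> {1..n}; i \<noteq> j\<rbrakk> \<Longrightarrow> refl_ij n i j \<in> weyl n (roots_A n)"
  by (rule weyl_refl_ij[OF root_set_subsets(1)])

text \<open>
  On the module \<open>x\<^sub>i c\<^sub>i = k \<Sum>\<^bsub>j<i\<^esub> s\<^bsub>i,j\<^esub> (c\<^sub>i - c\<^sub>j)\<close>, because \<open>c\<^sub>i c\<^sub>j c\<^sub>i = c\<^sub>j\<close>; this cancels the
  reflections of the Dirac element.
\<close>

lemma dirac_A_zero:
  "elt_A n k (dirac n (pos_roots_A n) (\<lambda>_. k)) \<in> carrier (H_A n k)"
  "v \<in> carrier (clifford n) \<Longrightarrow> act (elt_A n k (dirac n (pos_roots_A n) (\<lambda>_. k))) v = \<zero>\<^bsub>clifford n\<^esub>"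
proof -
  let ?A = "gens n (weyl n (roots_A n))"
  have D: "dirac n (pos_roots_A n) (\<lambda>_. k) \<in> carrier (free_algebra ?A)"
    by (rule dirac_carrier) (use root_set_subsets(1) in \<open>blast intro: weyl_reflection\<close>)
  then show "elt_A n k (dirac n (pos_roots_A n) (\<lambda>_. k)) \<in> carrier (H_A n k)"
    unfolding elt_A_def H_A_def by (rule P.cls_mem)
  assume v: "v \<in> carrier (clifford n)"
  have c: "cc i \<in> carrier (free_algebra ?A)" and x: "xx i \<in> carrier (free_algebra ?A)" if "i \<in> {1..n}" for i
    using that by (auto intro!: free_carrier_closed(4))
  have s: "ww (refl_ij n i j) \<in> carrier (free_algebra ?A)" if "i \<in> {1..n}" "j \<in> {1..<i}" for i j
    using that refl_ij_mem[of i j] by (auto intro!: free_carrier_closed(4))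
  have j: "j \<in> {1..n}" "i \<noteq> j" if "i \<in> {1..n}" "j \<in> {1..<i}" for i j
    using that by auto
  \<comment> \<open>\<open>y i\<close> is the polynomial through which x_i acts, and
    \<open>z i\<close> collects the roots whose larger index is \<open>i\<close>; the cancellation
    takes place for each \<open>i\<close> separately.\<close>
  define y where "y i = scal k * (\<Sum>j\<in>{1..<i}. ww (refl_ij n i j) * (1 - cc i * cc j))" for i
  define z where "z i = (\<Sum>j\<in>{1..<i}. scal k * (ww (refl_ij n i j) * (cc j - cc i)))" for i
  have y: "y i \<in> carrier (free_algebra ?A)" and z: "z i \<in> carrier (free_algebra ?A)" if "i \<in> {1..n}" for i
    unfolding y_def z_def using that c s j[OF that]
    by (auto intro!: free_carrier_sum free_carrier_mult free_carrier_diff simp del: atLeastLessThan_iff atLeastAtMost_iff)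
  have cl: "clifford_rels n \<subseteq> rels_A n k"
    by (auto simp: rels_A_def common_rels_def)
  \<comment> \<open>Writing zero as a sum over the same index set allows a comparison term by
    term.\<close>
  have "P.op (dirac n (pos_roots_A n) (\<lambda>_. k)) v = P.op (\<Sum>i\<in>{1..n}. 0) v"
    unfolding dirac_A
  proof (rule P.op_sum_cong)
    fix i assume i: "i \<in> {1..n}"
    note mem = c[OF i] x[OF i] y[OF i] z[OF i]
    show "xx i * cc i + (\<Sum>j\<in>{1..<i}. scal k * (ww (refl_ij n i j) * (cc j - cc i))) \<in> carrier (free_algebra ?A)"
      unfolding z_def[symmetric] using mem by (intro free_carrier_add free_carrier_mult)
    have "P.op (xx i * cc i + z i) v = P.op (y i * cc i + z i) v"
      using act_x[OF i, of "P.op (cc i) v"] mem v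
      by (simp add: P.op_add P.op_mult act_elt_A y_def del: sum_distrib_left)
    also have "\<dots> = P.op 0 v"
    proof (rule P.op_cong)
      \<comment> \<open>Up to \<open>k\<close> and the reflection, each term is (1 - c_i c_j) c_i +
        c_j - c_i = c_j - c_i c_j c_i. Writing it through the two Clifford relations makes its
        membership in the ideal visible.\<close>
      have "y i * cc i + z i = (\<Sum>j\<in>{1..<i}. scal k * (ww (refl_ij n i j) *
          ((cc i * cc i + 1) * cc j - cc i * (cc i * cc j + cc j * cc i))))"
        unfolding y_def z_def sum_distrib_left sum_distrib_right sum.distrib[symmetric]
        by (rule sum.cong) (simp_all add: algebra_simps)
      moreover have "\<dots> \<in> P.rel_ideal"
        using clifford_rel_mem[OF presentation_A cl i] c s[OF i] j[OF i] i
        by (intro P.rel_ideal_sum P.rel_ideal_mult_left P.rel_ideal_diff P.rel_ideal_mult_right) auto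
      ultimately show "y i * cc i + z i - 0 \<in> P.rel_ideal" by simp
    qed (use mem in auto)
    finally show "P.op (xx i * cc i + (\<Sum>j\<in>{1..<i}. scal k * (ww (refl_ij n i j) * (cc j - cc i)))) v
        = P.op 0 v"
      by (simp add: z_def)
  qed (use v in auto)
  then show "act (elt_A n k (dirac n (pos_roots_A n) (\<lambda>_. k))) v = \<zero>\<^bsub>clifford n\<^esub>"
    using v by (simp add: act_elt_A)
qed

end

section \<open>Types B and D\<close>

lemma half_sqrt2_square: "sqrt2 / 2 * (sqrt2 / 2) = 1 / 2"
  by simp

lemma scal_half: "scal (1 / 2) * (p + p) = p"
proof -
  have "scal (1 / 2) * (p + p) = scal (1 / 2 + 1 / 2) * p"
    unfolding scal_add distrib_left distrib_right ..
  then show ?thesis by simp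
qed

text \<open>Since \<open>a\<close>, \<open>b\<close> and \<open>e\<close> vanish in the Clifford
  algebra, multiplying c_j on both sides by the element of e_i - e_j gives c_i there. The explicit
  remainder in the free algebra exhibits the ideal membership.\<close>

lemma c_root_conj_short:
  fixes i j n :: nat
  defines "a \<equiv> cc i * cc j + cc j * cc i" and "b \<equiv> cc i * cc i + 1" and "e \<equiv> cc j * cc j + 1"
  assumes "i \<in> {1..n}" "j \<in> {1..n}" "i \<noteq> j"
  shows "c_root n (std_basis i - std_basis j) * (c_root n (std_basis j) * c_root n (std_basis i - std_basis j))
      - c_root n (std_basis i)
    = scal (1 / 2) * (cc i * a - b * cc j - cc i * e - e * cc i + e * cc j)"
proof -
  let ?s = "scal (sqrt2 / 2)" and ?d = "cc i - cc j"
  have "cc i * a - b * cc j - cc i * e - e * cc i + e * cc j = ?d * (cc j * ?d) - (cc i + cc i)"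
    by (simp add: a_def b_def e_def algebra_simps)
  moreover have "?s * ?d * (cc j * (?s * ?d)) = scal (1 / 2) * (?d * (cc j * ?d))"
    unfolding mult.assoc scal_pull[of "cc j"] scal_pull[of ?d] scal_scal half_sqrt2_square ..
  ultimately show ?thesis
    unfolding c_root_minus[OF assms(4-6)] c_root_short[OF assms(4)] c_root_short[OF assms(5)]
    by (simp only: right_diff_distrib[of "scal (1 / 2)"] scal_half)
qed

text \<open>Again the right-hand side is a combination of Clifford relations; the identity matches
  \<open>reflection_conj_plus\<close> on the level of Clifford elements.\<close>

lemma c_root_conj_plus:
  fixes i j n :: nat
  defines "a \<equiv> cc i * cc j + cc j * cc i" and "e \<equiv> cc j * cc j + 1"
  assumes "i \<in> {1..n}" "j \<in> {1..n}" "i \<noteq> j"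
  shows "c_root n (std_basis j) * (c_root n (std_basis i - std_basis j) * c_root n (std_basis j))
      - c_root n (std_basis i + std_basis j)
    = scal (sqrt2 / 2) * (a * cc j - cc i * e - e * cc j)"
proof -
  have "a * cc j - cc i * e - e * cc j = cc j * ((cc i - cc j) * cc j) - (cc i + cc j)"
    by (simp add: a_def e_def algebra_simps)
  then show ?thesis
    unfolding c_root_minus[OF assms(3-5)] c_root_plus[OF assms(3-5)] c_root_short[OF assms(4)]
      mult.assoc scal_pull[of "cc j"]
    by (simp only: right_diff_distrib[of "scal (sqrt2 / 2)"])
qed

text \<open>Modulo the Clifford relations both elements square to -1, as for any unit vector; the
  cross terms make up \<open>a\<close>.\<close>

lemma c_root_square:
  fixes i j n :: nat
  defines "a \<equiv> cc i * cc j + cc j * cc i" and "b \<equiv> cc i * cc i + 1" and "e \<equiv> cc j * cc j + 1"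
  assumes "i \<in> {1..n}" "j \<in> {1..n}" "i \<noteq> j"
  shows "c_root n (std_basis i - std_basis j) * c_root n (std_basis i - std_basis j) + 1
      = scal (1 / 2) * (b + e - a)"
    "c_root n (std_basis i + std_basis j) * c_root n (std_basis i + std_basis j) + 1
      = scal (1 / 2) * (b + e + a)"
proof -
  have sq: "scal (sqrt2 / 2) * p * (scal (sqrt2 / 2) * p) = scal (1 / 2) * (p * p)" for p :: "generator free"
    unfolding mult.assoc scal_pull[of p] scal_scal half_sqrt2_square ..
  have "b + e - a = (cc i - cc j) * (cc i - cc j) + (1 + 1)" "b + e + a = (cc i + cc j) * (cc i + cc j) + (1 + 1)"
    by (simp_all add: a_def b_def e_def algebra_simps)
  then show "c_root n (std_basis i - std_basis j) * c_root n (std_basis i - std_basis j) + 1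
      = scal (1 / 2) * (b + e - a)"
    "c_root n (std_basis i + std_basis j) * c_root n (std_basis i + std_basis j) + 1
      = scal (1 / 2) * (b + e + a)"
    by (simp_all only: c_root_minus[OF assms(4-6)] c_root_plus[OF assms(4-6)] sq distrib_left[of "scal (1 / 2)" _ "1 + 1"] scal_half)
qed

section \<open>Reflections on the type B module\<close>

locale steinberg_B_module = steinberg_B + assumes n_pos: "1 \<le> n"
begin

declare One_nat_def [simp del]

abbreviation W where "W \<equiv> weyl n (roots_B n)"

sublocale C: presented_module "Cgen ` {1..n}" "clifford_rels n" U actU
  using presentation_clifford[of n] algebra_module_axioms
  by (simp add: presented_module_def clifford_def)

sublocale H: presented_module "gens n W" "rels_B n k N" "tensor U U" act
  using presentation_B[OF n_pos, of k N] T.algebra_module_axioms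
  by (simp add: presented_module_def H_B_def)

sublocale TS: tensor_space U U
  by (simp add: tensor_space_def C.V.complex_space_axioms)

abbreviation CF where "CF \<equiv> carrier (free_algebra (Cgen ` {1..n}))"

abbreviation HF where "HF \<equiv> carrier (free_algebra (gens n W))"

lemma actU_elt: "actU (elt_Cl n p) u = C.op p u"
  by (simp add: elt_Cl_def C.op_def)

lemma act_elt: "act (elt_B n k N p) t = H.op p t"
  by (simp add: elt_B_def H.op_def)

lemma c_mem [simp, intro]: "i \<in> {1..n} \<Longrightarrow> cc i \<in> CF" "i \<in> {1..n} \<Longrightarrow> cc i \<in> HF"
  by (auto intro!: free_carrier_closed(4))

lemma c_root_mem [simp, intro]: "c_root n \<alpha> \<in> CF" "c_root n \<alpha> \<in> HF"
  by (auto intro!: c_root_carrier)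

lemma gr_carrier: "\<lbrakk>d \<in> {0, 1}; u \<in> gr d\<rbrakk> \<Longrightarrow> u \<in> carrier U"
  using C.V.subspaceD(1)[OF gr_submodule] by blast

text \<open>Each c_i reverses the degree and the graded pieces are subspaces; the induction runs
  over partial sums with arbitrary coefficients.\<close>

lemma c_root_odd:
  assumes "d \<in> {0, 1}" "u \<in> gr d"
  shows "C.op (c_root n \<alpha>) u \<in> gr (1 - d)"
proof -
  have d: "1 - d \<in> {0, 1}" using assms(1) by auto
  note D = C.V.subspaceD[OF gr_submodule[OF d]]
  have u: "u \<in> carrier U" using gr_carrier assms by blast
  have "C.op (\<Sum>i\<in>S. scal (a i) * cc i) u \<in> gr (1 - d)" if "finite S" "S \<subseteq> {1..n}" for S a
    using that
  proof (induction S rule: finite_induct)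
    case empty
    show ?case using D(2) u by simp
  next
    case (insert i S)
    then have i: "i \<in> {1..n}" and S: "(\<Sum>i\<in>S. scal (a i) * cc i) \<in> CF"
      by auto
    have "C.op (cc i) u \<in> gr (1 - d)"
      using gr_odd[of d i u] assms i by (simp add: actU_elt)
    then show ?case
      using insert D(3,4) u i S by (simp add: C.op_add C.op_scal)
  qed
  then show ?thesis unfolding c_root_def by simp
qed

text \<open>The sign in the action of c_i depends only on the degree of \<open>u\<close>, so the
  formula is linear in the Clifford vector.\<close>

lemma c_root_tensor:
  assumes "d \<in> {0, 1}" "u \<in> gr d" and v: "v \<in> carrier U"
  shows "H.op (c_root n \<alpha>) (TS.pt u v) = ((- 1) ^ d) \<odot>\<^bsub>tensor U U\<^esub> TS.pt u (C.op (c_root n \<alpha>) v)"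
proof -
  have u: "u \<in> carrier U" using gr_carrier assms by blast
  have "H.op (\<Sum>i\<in>S. scal (a i) * cc i) (TS.pt u v)
      = ((- 1) ^ d) \<odot>\<^bsub>tensor U U\<^esub> TS.pt u (C.op (\<Sum>i\<in>S. scal (a i) * cc i) v)"
    if "finite S" "S \<subseteq> {1..n}" for S a
    using that
  proof (induction S rule: finite_induct)
    case empty
    have "TS.pt u \<zero>\<^bsub>U\<^esub> = \<zero>\<^bsub>tensor U U\<^esub>"
      using TS.pt_smult_right[of u "\<zero>\<^bsub>U\<^esub>" 0] u by simp
    then show ?case using u v by simp
  next
    case (insert i S)
    have i: "i \<in> {1..n}" and S: "(\<Sum>i\<in>S. scal (a i) * cc i) \<in> CF" "(\<Sum>i\<in>S. scal (a i) * cc i) \<in> HF"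
      using insert.prems by auto
    have c: "H.op (cc i) (TS.pt u v) = ((- 1) ^ d) \<odot>\<^bsub>tensor U U\<^esub> TS.pt u (C.op (cc i) v)"
      using act_c[OF i assms] by (simp add: actU_elt act_elt)
    have "H.op (\<Sum>i\<in>insert i S. scal (a i) * cc i) (TS.pt u v)
        = a i \<odot>\<^bsub>tensor U U\<^esub> H.op (cc i) (TS.pt u v) \<oplus>\<^bsub>tensor U U\<^esub> H.op (\<Sum>i\<in>S. scal (a i) * cc i) (TS.pt u v)"
      using insert.hyps i S u v by (simp add: H.op_add H.op_scal)
    also have "\<dots> = ((- 1) ^ d) \<odot>\<^bsub>tensor U U\<^esub> TS.pt u (C.op (\<Sum>i\<in>insert i S. scal (a i) * cc i) v)"
      using insert.hyps insert.IH insert.prems i S u v c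
      by (simp add: C.op_add C.op_scal TS.pt_add_right TS.pt_smult_right H.V.smult_add H.V.smult_smult mult.commute)
    finally show ?case .
  qed
  then show ?thesis unfolding c_root_def by simp
qed

text \<open>The module prescribes this formula for e_n and for e_i - e_j; conjugation spreads it to
  all positive roots.\<close>

definition reflection_acts :: "vec \<Rightarrow> bool" where
  "reflection_acts \<alpha> \<longleftrightarrow> (\<forall>d\<in>{0, 1}. \<forall>u\<in>gr d. \<forall>v\<in>carrier U.
    H.op (ww (reflection n \<alpha>)) (TS.pt u v) = ((- 1) ^ d * \<i>) \<odot>\<^bsub>tensor U U\<^esub>
      TS.pt (C.op (c_root n \<alpha>) u) (C.op (c_root n \<alpha>) v))"

lemma reflection_actsD:
  "\<lbrakk>reflection_acts \<alpha>; d \<in> {0, 1}; u \<in> gr d; v \<in> carrier U\<rbrakk>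
    \<Longrightarrow> H.op (ww (reflection n \<alpha>)) (TS.pt u v) = ((- 1) ^ d * \<i>) \<odot>\<^bsub>tensor U U\<^esub>
      TS.pt (C.op (c_root n \<alpha>) u) (C.op (c_root n \<alpha>) v)"
  unfolding reflection_acts_def by blast

text \<open>
  The three signs of \<open>s\<^sub>\<beta> s\<^sub>\<alpha> s\<^sub>\<beta>\<close> combine correctly because each \<open>c\<^sub>\<beta>\<close>, \<open>c\<^sub>\<alpha>\<close> changes the parity of
  the left factor.
\<close>

lemma reflection_acts_conj:
  assumes \<alpha>: "reflection_acts \<alpha>" "reflection n \<alpha> \<in> W"
    and \<beta>: "reflection_acts \<beta>" "reflection n \<beta> \<in> W"
    and comp: "reflection n \<beta> \<circ> (reflection n \<alpha> \<circ> reflection n \<beta>) = reflection n \<gamma>"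
    and c: "c_root n \<beta> * (c_root n \<alpha> * c_root n \<beta>) - c_root n \<gamma> \<in> C.rel_ideal"
  shows "reflection_acts \<gamma>"
  unfolding reflection_acts_def
proof (intro ballI)
  fix d u v assume d: "d \<in> {0, 1 :: nat}" and u: "u \<in> gr d" and v: "v \<in> carrier U"
  let ?a = "ww (reflection n \<alpha>)" and ?b = "ww (reflection n \<beta>)"
  have mem: "ww w \<in> HF" if "w \<in> W" for w
    using that by (auto intro!: free_carrier_closed(4))
  \<comment> \<open>The group relations let a composite reflection act as the composite of the
    actions.\<close>
  have rel: "ww (w \<circ> w') - ww w * ww w' \<in> H.rel_ideal" if "w \<in> W" "w' \<in> W" for w w'
  proof -
    have "ww w * ww w' - ww (w \<circ> w') \<in> rels_B n k N"
      using that by (auto simp: rels_B_def Let_def common_rels_def group_rels_def)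
    then have "- (ww w * ww w' - ww (w \<circ> w')) \<in> H.rel_ideal"
      by (intro H.rel_ideal_uminus H.rels_rel_ideal)
    then show ?thesis by simp
  qed
  have W: "reflection n \<alpha> \<circ> reflection n \<beta> \<in> W" "reflection n \<gamma> \<in> W"
    using \<alpha> \<beta> by (auto intro: weyl_comp simp flip: comp)
  have opc: "H.op (ww (w \<circ> w')) t = H.op (ww w) (H.op (ww w') t)"
    if "w \<in> W" "w' \<in> W" "t \<in> carrier (tensor U U)" for w w' t
    using H.op_cong[OF _ _ rel[OF that(1,2)], of t] that weyl_comp[OF that(1,2)]
    by (simp add: H.op_mult mem)
  have uc: "u \<in> carrier U" using gr_carrier d u by blast
  let ?A = "C.op (c_root n \<alpha>)" and ?B = "C.op (c_root n \<beta>)"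
  have d': "1 - d \<in> {0, 1}" "1 - (1 - d) = d" using d by auto
  have Bu: "?B u \<in> gr (1 - d)" using c_root_odd d u by blast
  have ABu: "?A (?B u) \<in> gr d" using c_root_odd[OF d'(1) Bu] d'(2) by simp
  have car: "?B x \<in> carrier U" "?A x \<in> carrier U" if "x \<in> carrier U" for x
    using that by auto
  have g: "C.op (c_root n \<gamma>) x = ?B (?A (?B x))" if "x \<in> carrier U" for x
    using C.op_cong[OF _ _ c, of x] that by (simp add: C.op_mult)
  have "H.op (ww (reflection n \<gamma>)) (TS.pt u v) = H.op ?b (H.op ?a (H.op ?b (TS.pt u v)))"
    using opc W(1) \<alpha>(2) \<beta>(2) uc v by (simp flip: comp)
  also have "\<dots> = ((- 1) ^ d * \<i> * ((- 1) ^ (1 - d) * \<i> * ((- 1) ^ d * \<i>))) \<odot>\<^bsub>tensor U U\<^esub>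
      TS.pt (?B (?A (?B u))) (?B (?A (?B v)))"
    using reflection_actsD[OF \<beta>(1) d u v] reflection_actsD[OF \<alpha>(1) d'(1) Bu, of "?B v"]
      reflection_actsD[OF \<beta>(1) d ABu, of "?A (?B v)"] mem[OF \<alpha>(2)] mem[OF \<beta>(2)] uc v car
    by (simp add: H.op_vector_smult H.V.smult_smult mult.assoc)
  \<comment> \<open>The middle reflection meets degree 1 - d, which costs a factor -1, and the cube
    of the imaginary unit costs another.\<close>
  also have "(- 1) ^ d * \<i> * ((- 1) ^ (1 - d) * \<i> * ((- 1) ^ d * \<i>)) = (- 1) ^ d * \<i>"
    using d by auto
  finally show "H.op (ww (reflection n \<gamma>)) (TS.pt u v) = ((- 1) ^ d * \<i>) \<odot>\<^bsub>tensor U U\<^esub>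
      TS.pt (C.op (c_root n \<gamma>) u) (C.op (c_root n \<gamma>) v)"
    by (simp only: g uc v)
qed

lemma refl_ij_W: "\<lbrakk>i \<in> {1..n}; j \<in> {1..n}; i \<noteq> j\<rbrakk> \<Longrightarrow> refl_ij n i j \<in> W"
  by (rule weyl_refl_ij[OF root_set_subsets(2)])

lemma clifford_rel:
  "i \<in> {1..n} \<Longrightarrow> cc i * cc i + 1 \<in> C.rel_ideal"
  "\<lbrakk>i \<in> {1..n}; j \<in> {1..n}; i \<noteq> j\<rbrakk> \<Longrightarrow> cc i * cc j + cc j * cc i \<in> C.rel_ideal"
  using clifford_rel_mem[OF presentation_clifford order.refl, of _ n] by blast+

lemma reflection_acts_minus:
  assumes "i \<in> {1..n}" "j \<in> {1..n}" "i \<noteq> j"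
  shows "reflection_acts (std_basis i - std_basis j)"
  using act_sij[OF assms] unfolding reflection_acts_def c_root_minus[OF assms]
  by (simp add: act_elt actU_elt scal_inv_sqrt2)

text \<open>The root e_n is given; any other e_i comes from it by conjugation with the reflection in
  e_i - e_n.\<close>

lemma reflection_acts_short:
  assumes i: "i \<in> {1..n}"
  shows "reflection_acts (std_basis i)"
proof -
  have n: "n \<in> {1..n}" using n_pos by simp
  then have last: "reflection_acts (std_basis n)"
    using act_sn unfolding reflection_acts_def c_root_short[OF n]
    by (simp add: act_elt actU_elt)
  show ?thesis
  proof (cases "i = n")
    case False
    show ?thesis
    proof (rule reflection_acts_conj[OF last reflection_short_weyl[OF n]
          reflection_acts_minus[OF i n False] refl_ij_W[OF i n False]])
        \<comment> \<open>With arbitrary ideal elements in place of the relations, only closure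
          properties of the ideal are used and no polynomial is expanded.\<close>
        have I: "scal (1 / 2) * (cc i * a - b * cc n - cc i * e - e * cc i + e * cc n) \<in> C.rel_ideal"
        if "a \<in> C.rel_ideal" "b \<in> C.rel_ideal" "e \<in> C.rel_ideal" for a b e
      proof -
        have "cc i * a \<in> C.rel_ideal" "b * cc n \<in> C.rel_ideal" "cc i * e \<in> C.rel_ideal"
          "e * cc i \<in> C.rel_ideal" "e * cc n \<in> C.rel_ideal"
          using that i n by (auto simp: C.rel_ideal_mult_left C.rel_ideal_mult_right)
        then show ?thesis
          by (simp add: C.rel_ideal_mult_left C.rel_ideal_add C.rel_ideal_diff)
      qed
      show "c_root n (std_basis i - std_basis n) * (c_root n (std_basis n) * c_root n (std_basis i - std_basis n))
          - c_root n (std_basis i) \<in> C.rel_ideal"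
        unfolding c_root_conj_short[OF i n False]
        by (rule I[OF clifford_rel(2)[OF i n False] clifford_rel(1)[OF i] clifford_rel(1)[OF n]])
    qed (rule reflection_conj_short[OF i n False])
  qed (use last in simp)
qed

text \<open>Here e_i - e_j is conjugated by the reflection in e_j, which is already treated.\<close>

lemma reflection_acts_plus:
  assumes ij: "i \<in> {1..n}" "j \<in> {1..n}" "i \<noteq> j"
  shows "reflection_acts (std_basis i + std_basis j)"
proof (rule reflection_acts_conj[OF reflection_acts_minus[OF ij] refl_ij_W[OF ij]
      reflection_acts_short[OF ij(2)] reflection_short_weyl[OF ij(2)] reflection_conj_plus[OF ij]])
  have I: "scal (sqrt2 / 2) * (a * cc j - cc i * e - e * cc j) \<in> C.rel_ideal"
    if "a \<in> C.rel_ideal" "e \<in> C.rel_ideal" for a e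
  proof -
    have "a * cc j \<in> C.rel_ideal" "cc i * e \<in> C.rel_ideal" "e * cc j \<in> C.rel_ideal"
      using that ij by (auto simp: C.rel_ideal_mult_left C.rel_ideal_mult_right)
    then show ?thesis
      by (simp add: C.rel_ideal_mult_left C.rel_ideal_diff)
  qed
  show "c_root n (std_basis j) * (c_root n (std_basis i - std_basis j) * c_root n (std_basis j))
      - c_root n (std_basis i + std_basis j) \<in> C.rel_ideal"
    unfolding c_root_conj_plus[OF ij] by (rule I[OF clifford_rel(2)[OF ij] clifford_rel(1)[OF ij(2)]])
qed

lemma pos_root_acts:
  assumes "\<alpha> \<in> pos_roots_B n"
  shows "reflection_acts \<alpha>" "c_root n \<alpha> * c_root n \<alpha> + 1 \<in> C.rel_ideal"
proof -
  from assms show "reflection_acts \<alpha>"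
    by (cases rule: pos_roots_B_cases)
      (auto intro: reflection_acts_short reflection_acts_minus reflection_acts_plus)
  from assms show "c_root n \<alpha> * c_root n \<alpha> + 1 \<in> C.rel_ideal"
  proof (cases rule: pos_roots_B_cases)
    case (short i)
    then show ?thesis using clifford_rel(1) by (simp add: c_root_short)
  next
    case (long i j)
    note ij = long(1-3)
    have "scal (1 / 2) * (b + e - a) \<in> C.rel_ideal" "scal (1 / 2) * (b + e + a) \<in> C.rel_ideal"
      if "a \<in> C.rel_ideal" "b \<in> C.rel_ideal" "e \<in> C.rel_ideal" for a b e
      using that by (auto intro: C.rel_ideal_mult_left C.rel_ideal_add C.rel_ideal_diff)
    from this[OF clifford_rel(2)[OF ij] clifford_rel(1)[OF ij(1)] clifford_rel(1)[OF ij(2)]] show ?thesis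
      using long(4) c_root_square[OF ij] by metis
  qed
qed

lemma square_minus_one:
  assumes "p \<in> CF" "p * p + 1 \<in> C.rel_ideal" "v \<in> carrier U"
  shows "C.op p (C.op p v) = (- 1) \<odot>\<^bsub>U\<^esub> v"
proof -
  have "C.op (p * p) v = C.op (scal (- 1) * 1) v"
    using assms by (intro C.op_cong) auto
  then show ?thesis
    using assms C.op_scal[of 1 v "- 1"] by (simp add: C.op_mult)
qed

end

text \<open>The term at \<open>j\<close> occurs once for each i with j < i \<le> n, that is, n - j
  times.\<close>

lemma sum_triangle:
  "(\<Sum>i\<in>{1..n}. \<Sum>j\<in>{1..<i}. f j) = (\<Sum>j\<in>{1..n}. scal (of_nat (n - j)) * f j)"
proof (induction n)
  case (Suc n)
  have "(\<Sum>j\<in>{1..Suc n}. scal (of_nat (Suc n - j)) * f j) = (\<Sum>j\<in>{1..n}. scal (of_nat (Suc n - j)) * f j)"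
    by simp
  also have "\<dots> = (\<Sum>j\<in>{1..n}. scal (of_nat (n - j)) * f j + f j)"
  proof (rule sum.cong)
    fix j assume "j \<in> {1..n}"
    then have "scal (of_nat (Suc n - j)) * f j = (scal (of_nat (n - j)) + 1) * f j"
      by (simp only: Suc_diff_le[of j n] atLeastAtMost_iff of_nat_Suc scal_add scal_simps add.commute)
    then show "scal (of_nat (Suc n - j)) * f j = scal (of_nat (n - j)) * f j + f j"
      by (simp add: distrib_right)
  qed simp
  finally show ?case
    using Suc by (simp add: sum.distrib atLeastLessThanSuc_atLeastAtMost)
qed simp

text \<open>Let S be the double sum of c_j over j < i. By \<open>sum_triangle\<close> both long
  parts of the x_i sum to S, while the long roots contribute -2 S, each with factor
  \<open>ka\<close> times the imaginary unit; the short parts are opposite. The identity holds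
  already in the free algebra.\<close>

lemma dirac_B_cancellation:
  fixes ka kb :: complex
  assumes long: "\<And>i j. \<lbrakk>i \<in> {1..n}; j \<in> {1..n}; i \<noteq> j\<rbrakk>
      \<Longrightarrow> k (std_basis i - std_basis j) = ka \<and> k (std_basis i + std_basis j) = ka"
    and short: "\<And>i. i \<in> {1..n} \<Longrightarrow> k (std_basis i) = kb"
  shows "(\<Sum>i=1..n. scal \<i> * (scal ka * ((\<Sum>j\<in>{1..<i}. cc j) + scal (of_nat (n - i)) * cc i)
            + scal (sqrt2 / 2 * kb) * cc i))
      + scal (sqrt2 / 2) * (\<Sum>\<alpha>\<in>pos_roots_B n. scal (k \<alpha> * complex_of_real (ip n \<alpha> \<alpha>)) *
          (scal (- \<i>) * c_root n \<alpha>)) = 0"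
proof -
  let ?g = "\<lambda>\<alpha>. scal (sqrt2 / 2) * (scal (k \<alpha> * complex_of_real (ip n \<alpha> \<alpha>)) * (scal (- \<i>) * c_root n \<alpha>))"
  let ?S = "\<Sum>i\<in>{1..n}. \<Sum>j\<in>{1..<i}. cc j" and ?K = "\<Sum>i\<in>{1..n}. cc i"
  \<comment> \<open>The contributions of c_i cancel between the two roots, while those of c_j add
    up.\<close>
  have pair: "?g (std_basis j - std_basis i) + ?g (std_basis j + std_basis i) = scal (- (2 * \<i> * ka)) * cc j"
    if "i \<in> {1..n}" "j \<in> {1..<i}" for i j
  proof -
    have j: "j \<in> {1..n}" "j \<noteq> i" using that by auto
    note ji = j(1) that(1) j(2)
    have m: "scal (sqrt2 / 2) * (scal (ka * complex_of_real 2) * (scal (- \<i>) * (scal (sqrt2 / 2) * q)))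
        = scal (- (\<i> * ka)) * q" for q :: "generator free"
    proof -
      \<comment> \<open>With a symbol \<open>s\<close> for sqrt2, the irrational constant enters
        only through the square of its half.\<close>
      have "s / 2 * (ka * 2 * (- \<i> * (s / 2))) = s / 2 * (s / 2) * (- 2 * \<i> * ka)" for s :: complex
        by (simp add: field_simps)
      from this[of sqrt2] have "sqrt2 / 2 * (ka * complex_of_real 2 * (- \<i> * (sqrt2 / 2))) = - (\<i> * ka)"
        unfolding half_sqrt2_square by simp
      then show ?thesis
        unfolding scal_scal by (simp only:)
    qed
    have "scal x * (p - q) + scal x * (p + q) = scal (2 * x) * p" for x and p q :: "generator free"
    proof -
      have "scal (2 * x) * p = scal x * p + scal x * p"
        by (simp flip: scal_add distrib_right)
      then show ?thesis by (simp add: right_diff_distrib distrib_left)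
    qed
    then show ?thesis
      using long[OF ji] ip_long[OF ji] unfolding c_root_minus[OF ji] c_root_plus[OF ji]
      by (simp only: m) (simp add: mult.assoc)
  qed
  have single: "?g (std_basis i) = scal (- (\<i> * (sqrt2 / 2) * kb)) * cc i" if "i \<in> {1..n}" for i
    using short[OF that] that unfolding c_root_short[OF that] scal_scal by (simp add: ac_simps)
  have "scal (sqrt2 / 2) * (\<Sum>\<alpha>\<in>pos_roots_B n. scal (k \<alpha> * complex_of_real (ip n \<alpha> \<alpha>)) *
          (scal (- \<i>) * c_root n \<alpha>)) = sum ?g (pos_roots_B n)"
    by (simp only: sum_distrib_left)
  also have "\<dots> = (\<Sum>i\<in>{1..n}. \<Sum>j\<in>{1..<i}. ?g (std_basis j - std_basis i) + ?g (std_basis j + std_basis i))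
      + (\<Sum>i\<in>{1..n}. ?g (std_basis i))"
    by (simp only: sum_pos_roots_B sum_pos_roots_D sum.distrib)
  also have "\<dots> = (\<Sum>i\<in>{1..n}. \<Sum>j\<in>{1..<i}. scal (- (2 * \<i> * ka)) * cc j)
      + (\<Sum>i\<in>{1..n}. scal (- (\<i> * (sqrt2 / 2) * kb)) * cc i)"
    by (intro arg_cong2[of _ _ _ _ "(+)"] sum.cong refl pair single)
  also have "\<dots> = scal (- (2 * \<i> * ka)) * ?S + scal (- (\<i> * (sqrt2 / 2) * kb)) * ?K"
    by (simp only: sum_distrib_left)
  finally have right: "scal (sqrt2 / 2) * (\<Sum>\<alpha>\<in>pos_roots_B n. scal (k \<alpha> * complex_of_real (ip n \<alpha> \<alpha>)) *
          (scal (- \<i>) * c_root n \<alpha>)) = scal (- (2 * \<i> * ka)) * ?S + scal (- (\<i> * (sqrt2 / 2) * kb)) * ?K" .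
  have "(\<Sum>i=1..n. scal \<i> * (scal ka * ((\<Sum>j\<in>{1..<i}. cc j) + scal (of_nat (n - i)) * cc i)
            + scal (sqrt2 / 2 * kb) * cc i))
      = (\<Sum>i\<in>{1..n}. scal (\<i> * ka) * (\<Sum>j\<in>{1..<i}. cc j) + scal (\<i> * ka) * (scal (of_nat (n - i)) * cc i)
            + scal (\<i> * (sqrt2 / 2) * kb) * cc i)"
    by (rule sum.cong) (simp_all only: distrib_left scal_mult mult.assoc)
  also have "\<dots> = scal (\<i> * ka) * ?S + scal (\<i> * ka) * (\<Sum>i\<in>{1..n}. scal (of_nat (n - i)) * cc i)
      + scal (\<i> * (sqrt2 / 2) * kb) * ?K"
    by (simp only: sum.distrib sum_distrib_left)
  also have "\<dots> = scal (\<i> * ka) * ?S + scal (\<i> * ka) * ?S + scal (\<i> * (sqrt2 / 2) * kb) * ?K"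
    by (simp only: sum_triangle)
  finally show ?thesis
    unfolding right by (simp add: scal_add[of "\<i> * ka" "\<i> * ka", symmetric] flip: distrib_right)
qed

section \<open>The Dirac element on the type B module\<close>

context steinberg_B_module
begin

text \<open>The Clifford element by which x_i acts on the left factor, up to sign and imaginary
  unit.\<close>

definition x_left :: "nat \<Rightarrow> generator free" where
  "x_left i = scal ka * ((\<Sum>j\<in>{1..<i}. cc j) + scal (of_nat (n - i)) * cc i) + scal (sqrt2 / 2 * kb) * cc i"

lemma x_left_mem: "i \<in> {1..n} \<Longrightarrow> x_left i \<in> CF"
  unfolding x_left_def
  by (intro free_carrier_add free_carrier_mult free_carrier_sum free_carrier_closed(3) c_mem) auto

context
  fixes d :: nat and u v
  assumes d: "d \<in> {0, 1}" and u: "u \<in> gr d" and v: "v \<in> carrier U"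
begin

lemma u_mem: "u \<in> carrier U"
  using gr_carrier d u by blast

text \<open>For a fixed homogeneous \<open>u\<close>, the polynomial \<open>p\<close> acts on the
  left factor alone, as \<open>q\<close>. Including the carrier conditions makes the relation closed
  under sums and scalars, so the Dirac element can be assembled term by term.\<close>

definition left_op :: "generator free \<Rightarrow> generator free \<Rightarrow> bool" where
  "left_op p q \<longleftrightarrow> p \<in> HF \<and> q \<in> CF \<and> H.op p (TS.pt u v) = TS.pt (C.op q u) v"

lemma left_op_add: "\<lbrakk>left_op p q; left_op p' q'\<rbrakk> \<Longrightarrow> left_op (p + p') (q + q')"
  using u_mem v by (simp add: left_op_def H.op_add C.op_add TS.pt_add_left)

lemma left_op_scal: "left_op p q \<Longrightarrow> left_op (scal a * p) (scal a * q)"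
  using u_mem v by (simp add: left_op_def H.op_scal C.op_scal TS.pt_smult_left)

lemma left_op_zero: "left_op 0 0"
  using TS.pt_smult_left[of "\<zero>\<^bsub>U\<^esub>" v 0] u_mem v by (simp add: left_op_def)

lemma left_op_sum: "(\<And>i. i \<in> S \<Longrightarrow> left_op (f i) (g i)) \<Longrightarrow> left_op (sum f S) (sum g S)"
  by (induction S rule: infinite_finite_induct) (auto simp: left_op_zero intro: left_op_add)

text \<open>The degree signs of x_i and c_i cancel. On the right factor c_i acts twice, which gives
  -1 and turns the remaining minus sign into plus.\<close>

lemma left_op_xc:
  assumes i: "i \<in> {1..n}"
  shows "left_op (xx i * cc i) (scal \<i> * x_left i)"
proof -
  have x: "xx i \<in> HF" using i by (auto intro!: free_carrier_closed(4))
  have cv: "C.op (cc i) v \<in> carrier U" using i v by auto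
  have act: "H.op (xx i) (TS.pt u (C.op (cc i) v)) = (- ((- 1) ^ d * \<i>)) \<odot>\<^bsub>tensor U U\<^esub>
      TS.pt (C.op (x_left i) u) (C.op (cc i) (C.op (cc i) v))"
    using act_x[OF i d u cv] unfolding act_elt actU_elt x_left_def .
  have "H.op (xx i * cc i) (TS.pt u v)
      = ((- 1) ^ d * - ((- 1) ^ d * \<i>)) \<odot>\<^bsub>tensor U U\<^esub> TS.pt (C.op (x_left i) u) (C.op (cc i) (C.op (cc i) v))"
    using act_c[OF i d u v] act x i u_mem v cv x_left_mem[OF i]
    by (simp add: act_elt actU_elt H.op_mult H.op_vector_smult H.V.smult_smult)
  also have "C.op (cc i) (C.op (cc i) v) = (- 1) \<odot>\<^bsub>U\<^esub> v"
    using square_minus_one[OF _ clifford_rel(1)] i v by auto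
  also have "((- 1) ^ d * - ((- 1) ^ d * \<i>)) \<odot>\<^bsub>tensor U U\<^esub> TS.pt (C.op (x_left i) u) ((- 1) \<odot>\<^bsub>U\<^esub> v)
      = ((- 1) ^ d * - ((- 1) ^ d * \<i>) * - 1) \<odot>\<^bsub>tensor U U\<^esub> TS.pt (C.op (x_left i) u) v"
    using u_mem v x_left_mem[OF i] by (simp add: TS.pt_smult_right H.V.smult_smult)
  also have "(- 1) ^ d * - ((- 1) ^ d * \<i>) * - 1 = \<i>"
    using d by auto
  finally show ?thesis
    using x i u_mem v x_left_mem[OF i] by (simp add: left_op_def C.op_scal TS.pt_smult_left)
qed

text \<open>The degree signs cancel as for x_i c_i, and the square of the root element on the right
  factor gives -1. The prescribed action of x_i has one more minus sign, hence the opposite result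
  here.\<close>

lemma left_op_reflection:
  assumes \<alpha>: "\<alpha> \<in> pos_roots_B n"
  shows "left_op (ww (reflection n \<alpha>) * c_root n \<alpha>) (scal (- \<i>) * c_root n \<alpha>)"
proof -
  have w: "ww (reflection n \<alpha>) \<in> HF"
    using weyl_reflection[OF subsetD[OF root_set_subsets(6) \<alpha>]]
    by (intro free_carrier_closed(4)) simp
  have cv: "C.op (c_root n \<alpha>) v \<in> carrier U" using v by auto
  have "H.op (ww (reflection n \<alpha>) * c_root n \<alpha>) (TS.pt u v)
      = ((- 1) ^ d * ((- 1) ^ d * \<i>)) \<odot>\<^bsub>tensor U U\<^esub>
        TS.pt (C.op (c_root n \<alpha>) u) (C.op (c_root n \<alpha>) (C.op (c_root n \<alpha>) v))"
    using c_root_tensor[OF d u v, of \<alpha>] reflection_actsD[OF pos_root_acts(1)[OF \<alpha>] d u cv] w u_mem v cv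
    by (simp add: H.op_mult H.op_vector_smult H.V.smult_smult)
  also have "C.op (c_root n \<alpha>) (C.op (c_root n \<alpha>) v) = (- 1) \<odot>\<^bsub>U\<^esub> v"
    using square_minus_one[OF _ pos_root_acts(2)[OF \<alpha>]] v by auto
  also have "((- 1) ^ d * ((- 1) ^ d * \<i>)) \<odot>\<^bsub>tensor U U\<^esub> TS.pt (C.op (c_root n \<alpha>) u) ((- 1) \<odot>\<^bsub>U\<^esub> v)
      = ((- 1) ^ d * ((- 1) ^ d * \<i>) * - 1) \<odot>\<^bsub>tensor U U\<^esub> TS.pt (C.op (c_root n \<alpha>) u) v"
    using u_mem v by (simp add: TS.pt_smult_right H.V.smult_smult)
  also have "(- 1) ^ d * ((- 1) ^ d * \<i>) * - 1 = - \<i>"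
    using d by auto
  finally show ?thesis
    using w u_mem v C.op_scal[of "c_root n \<alpha>" u "- \<i>"]
    by (simp add: left_op_def TS.pt_smult_left)
qed

end

lemma dirac_B_mem: "dirac n (pos_roots_B n) k' \<in> HF"
  by (rule dirac_carrier) (use root_set_subsets(6) in \<open>blast intro: weyl_reflection\<close>)

text \<open>On u \<otimes> v with homogeneous \<open>u\<close>, the Dirac element acts through the
  polynomial of \<open>dirac_B_cancellation\<close>, which is 0. The grading gives all pure tensors,
  and these span.\<close>

lemma dirac_B_zero:
  assumes long: "\<And>i j. \<lbrakk>i \<in> {1..n}; j \<in> {1..n}; i \<noteq> j\<rbrakk>
      \<Longrightarrow> k (std_basis i - std_basis j) = ka \<and> k (std_basis i + std_basis j) = ka"
    and short: "\<And>i. i \<in> {1..n} \<Longrightarrow> k (std_basis i) = kb"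
    and t: "t \<in> carrier (tensor U U)"
  shows "H.op (dirac n (pos_roots_B n) k) t = \<zero>\<^bsub>tensor U U\<^esub>"
proof -
  let ?D = "dirac n (pos_roots_B n) k" and ?Z = "\<zero>\<^bsub>tensor U U\<^esub>"
  have homogeneous: "H.op ?D (TS.pt u v) = ?Z" if "d \<in> {0, 1}" "u \<in> gr d" "v \<in> carrier U" for d u v
  proof -
    have "left_op u v ?D ((\<Sum>i=1..n. scal \<i> * x_left i)
      + scal (sqrt2 / 2) * (\<Sum>\<alpha>\<in>pos_roots_B n. scal (k \<alpha> * complex_of_real (ip n \<alpha> \<alpha>)) *
          (scal (- \<i>) * c_root n \<alpha>)))"
      unfolding dirac_def using that
      by (intro left_op_add left_op_scal left_op_sum left_op_xc left_op_reflection)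
    then have "left_op u v ?D 0"
      using dirac_B_cancellation[OF long short] by (simp add: x_left_def)
    \<comment> \<open>The zero polynomial is also related to 0, so the Dirac element and 0 send the
      pure tensor to the same vector.\<close>
    then show ?thesis
      using left_op_zero[OF that] that(3) gr_carrier[OF that(1,2)] by (simp add: left_op_def[OF that])
  qed
  have "carrier (tensor U U) \<subseteq> {t \<in> carrier (tensor U U). H.op ?D t = ?Z}"
  proof (rule TS.tensor_spanned)
    fix u v assume uv: "u \<in> carrier U" "v \<in> carrier U"
    obtain u0 u1 where u01: "u0 \<in> gr 0" "u1 \<in> gr 1" "u = u0 \<oplus>\<^bsub>U\<^esub> u1"
      using uv(1) unfolding gr_sum set_add_def' by auto
    have c: "u0 \<in> carrier U" "u1 \<in> carrier U"
      using gr_carrier[of 0] gr_carrier[of 1] u01 by auto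
    have "TS.pt u v = TS.pt u0 v \<oplus>\<^bsub>tensor U U\<^esub> TS.pt u1 v"
      using c uv u01(3) by (simp add: TS.pt_add_left)
    then show "TS.pt u v \<in> {t \<in> carrier (tensor U U). H.op ?D t = ?Z}"
      using homogeneous[of 0 u0 v] homogeneous[of 1 u1 v] u01 c uv dirac_B_mem
      by (simp add: H.op_vector_add)
  qed (use dirac_B_mem H.op_vector_smult[of ?D ?Z 0] in \<open>auto simp: H.op_vector_add H.op_vector_smult\<close>)
  then show ?thesis using t by blast
qed

text \<open>The operator \<open>T\<close> is kept abstract so that it can be the type B action or
  its restriction to the type D subalgebra.\<close>

lemma dirac_B_conclusion:
  assumes D: "D \<in> HF" "\<And>t. t \<in> carrier (tensor U U) \<Longrightarrow> T t = H.op D t"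
    and zero: "\<And>t. t \<in> carrier (tensor U U) \<Longrightarrow> H.op D t = \<zero>\<^bsub>tensor U U\<^esub>"
  shows "\<forall>t\<in>carrier (tensor U U). T t = \<zero>\<^bsub>tensor U U\<^esub>"
    "carrier (dirac_cohomology (tensor U U) T) \<noteq> {\<zero>\<^bsub>dirac_cohomology (tensor U U) T\<^esub>}"
  using H.V.dirac_cohomology_nonzero[of T] TS.tensor_nonzero nonzero assms by auto

end

section \<open>Type D inside type B\<close>

lemma k_ext_short:
  assumes "i \<in> {1..n}"
  shows "k_ext n k (std_basis i) = 0"
proof -
  have "std_basis i \<notin> roots_D n"
  proof
    assume "std_basis i \<in> roots_D n"
    then obtain \<beta> where \<beta>: "\<beta> \<in> pos_roots_D n" "std_basis i = \<beta> \<or> std_basis i = - \<beta>"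
      by (auto simp: roots_D_def)
    then have "ip n \<beta> \<beta> = ip n (std_basis i) (std_basis i)"
      by auto
    moreover have "ip n \<beta> \<beta> = 2"
      using \<beta>(1) ip_long unfolding pos_roots_D_def by fastforce
    ultimately show False using assms by simp
  qed
  then show ?thesis by (simp add: k_ext_def)
qed

text \<open>The extended parameter vanishes on the short roots, so the two Dirac elements agree as
  polynomials and the type B computation carries over.\<close>

lemma dirac_D_eq: "dirac n (pos_roots_B n) (k_ext n k) = dirac n (pos_roots_D n) (\<lambda>_. k)"
proof -
  have "k_ext n k \<alpha> = k" if "\<alpha> \<in> pos_roots_D n" for \<alpha>
    using that root_set_subsets(7) by (auto simp: k_ext_def)
  then show ?thesis
    unfolding dirac_def sum_pos_roots_B by (simp add: k_ext_short)
qed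

lemma k_ext_long:
  assumes "i \<in> {1..n}" "j \<in> {1..n}" "i \<noteq> j"
  shows "k_ext n k (std_basis i - std_basis j) = k" "k_ext n k (std_basis i + std_basis j) = k"
proof -
  have "std_basis i - std_basis j \<in> roots_D n" "std_basis i + std_basis j \<in> roots_D n"
    "- (std_basis i - std_basis j) \<in> roots_D n"
    if "1 \<le> i" "i < j" "j \<le> n" for i j
    using that unfolding roots_D_def pos_roots_D_def by blast+
  note D = this
  consider "1 \<le> i" "i < j" "j \<le> n" | "1 \<le> j" "j < i" "i \<le> n"
    using assms by fastforce
  then have "std_basis i - std_basis j \<in> roots_D n \<and> std_basis i + std_basis j \<in> roots_D n"
    by (cases; use D[of i j] D[of j i] in \<open>simp add: add.commute\<close>)
  then show "k_ext n k (std_basis i - std_basis j) = k" "k_ext n k (std_basis i + std_basis j) = k"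
    by (simp_all add: k_ext_def)
qed

section \<open>Conclusions for the three types\<close>

lemma steinberg_A_conclusion:
  assumes "steinberg_A n k act"
  shows "let D = elt_A n k (dirac n (pos_roots_A n) (\<lambda>_. k)); V = clifford n in
    D \<in> carrier (H_A n k) \<and> (\<forall>v\<in>carrier V. act D v = \<zero>\<^bsub>V\<^esub>) \<and>
    carrier (dirac_cohomology V (act D)) \<noteq> {\<zero>\<^bsub>dirac_cohomology V (act D)\<^esub>}"
proof -
  interpret steinberg_A n k act by fact
  interpret V: complex_space "clifford n"
    by (simp add: complex_space_def V.module_axioms)
  show ?thesis
    using dirac_A_zero V.dirac_cohomology_nonzero[OF dirac_A_zero(2) clifford_nonzero]
    by (simp add: Let_def)
qed

lemma steinberg_B_conclusion:
  assumes "1 \<le> n" "weyl_invariant n (roots_B n) k" "2 \<le> n \<longrightarrow> \<alpha> \<in> long_roots_B n" "\<beta> \<in> short_roots_B n"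
    and "steinberg_B n k (k \<alpha>) (k \<beta>) N U gr actU act"
  shows "let D = elt_B n k N (dirac n (pos_roots_B n) k); V = tensor U U in
    D \<in> carrier (H_B n k N) \<and> (\<forall>v\<in>carrier V. act D v = \<zero>\<^bsub>V\<^esub>) \<and>
    carrier (dirac_cohomology V (act D)) \<noteq> {\<zero>\<^bsub>dirac_cohomology V (act D)\<^esub>}"
proof -
  interpret steinberg_B_module n k "k \<alpha>" "k \<beta>" N U gr actU act
    using assms(1,5) by (simp add: steinberg_B_module_def steinberg_B_module_axioms_def)
  have zero: "H.op (dirac n (pos_roots_B n) k) t = \<zero>\<^bsub>tensor U U\<^esub>" if "t \<in> carrier (tensor U U)" for t
  proof (rule dirac_B_zero[OF _ _ that])
    fix i j assume ij: "i \<in> {1..n}" "j \<in> {1..n}" "i \<noteq> j"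
    \<comment> \<open>Two distinct indices force rank at least two, which is where \<alpha> is known
      to be a long root.\<close>
    then have "2 \<le> n" by auto
    then show "k (std_basis i - std_basis j) = k \<alpha> \<and> k (std_basis i + std_basis j) = k \<alpha>"
      using k_long[OF assms(2) _ ij] assms(3) by blast
  qed (rule k_short[OF assms(2,4)])
  have "elt_B n k N (dirac n (pos_roots_B n) k) \<in> carrier (H_B n k N)"
    unfolding elt_B_def H_B_def using dirac_B_mem by (rule H.cls_mem)
  then show ?thesis
    using dirac_B_conclusion[OF dirac_B_mem act_elt zero] by (simp add: Let_def)
qed

text \<open>Written over the long roots only, the Dirac element uses just the generators of
  \<open>H_D\<close>, so it lies in the subalgebra and the restricted action agrees there with the
  type B action.\<close>

lemma steinberg_D_conclusion:
  assumes "1 \<le> n" "steinberg_D n k N U gr actU act"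
  shows "let D = elt_B n (k_ext n k) N (dirac n (pos_roots_D n) (\<lambda>_. k)); V = tensor U U in
    D \<in> carrier (H_D n k N) \<and> (\<forall>v\<in>carrier V. act D v = \<zero>\<^bsub>V\<^esub>) \<and>
    carrier (dirac_cohomology V (act D)) \<noteq> {\<zero>\<^bsub>dirac_cohomology V (act D)\<^esub>}"
proof -
  obtain actB where B: "steinberg_B n (k_ext n k) k 0 N U gr actU actB"
    and act: "act = restrict actB (carrier (H_D n k N))"
    using assms(2) by (auto simp: steinberg_D_def)
  interpret steinberg_B_module n "k_ext n k" k 0 N U gr actU actB
    using assms(1) B by (simp add: steinberg_B_module_def steinberg_B_module_axioms_def)
  let ?p = "dirac n (pos_roots_D n) (\<lambda>_. k)"
  let ?D = "elt_B n (k_ext n k) N ?p"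
  have W: "weyl n (roots_D n) \<subseteq> W"
    by (rule weyl_mono[OF root_set_subsets(5)])
  have "?p \<in> carrier (free_algebra (gens n (weyl n (roots_D n))))"
    by (rule dirac_carrier) (use root_set_subsets(7) in \<open>blast intro: weyl_reflection\<close>)
  then have D: "?D \<in> carrier (H_D n k N)"
    unfolding H_D_def elt_B_def H_B_def by (rule H.subalgebra_gen_cls[OF gens_mono[OF W]])
  have zero: "H.op ?p t = \<zero>\<^bsub>tensor U U\<^esub>" if "t \<in> carrier (tensor U U)" for t
    using dirac_B_zero[OF _ _ that] k_ext_long k_ext_short by (simp add: dirac_D_eq)
  have "?p \<in> HF"
    using dirac_B_mem[of "k_ext n k"] by (simp add: dirac_D_eq)
  then show ?thesis
    using dirac_B_conclusion[of ?p "act ?D"] D zero by (simp add: Let_def act act_elt)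
qed

theorem proposition5p2:
  fixes n :: nat
  assumes "1 \<le> n"
  shows
    "(\<forall>(k::complex) act. steinberg_A n k act \<longrightarrow>
        (let D = elt_A n k (dirac n (pos_roots_A n) (\<lambda>_. k)); V = clifford n in
           D \<in> carrier (H_A n k) \<and>
           (\<forall>v\<in>carrier V. act D v = \<zero>\<^bsub>V\<^esub>) \<and>
           carrier (dirac_cohomology V (act D)) \<noteq> {\<zero>\<^bsub>dirac_cohomology V (act D)\<^esub>}))
   \<and> (\<forall>(k::vec \<Rightarrow> complex) \<alpha> \<beta> (U::(complex, 'u) module) gr actU act.
        weyl_invariant n (roots_B n) k \<longrightarrow>
        (2 \<le> n \<longrightarrow> \<alpha> \<in> long_roots_B n) \<longrightarrow> \<beta> \<in> short_roots_B n \<longrightarrow>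
        (let N = 2 * (of_nat n - 1) * (k \<alpha>)\<^sup>2 + sqrt2 * k \<alpha> * k \<beta>;
             D = elt_B n k N (dirac n (pos_roots_B n) k); V = tensor U U in
         steinberg_B n k (k \<alpha>) (k \<beta>) N U gr actU act \<longrightarrow>
           D \<in> carrier (H_B n k N) \<and>
           (\<forall>v\<in>carrier V. act D v = \<zero>\<^bsub>V\<^esub>) \<and>
           carrier (dirac_cohomology V (act D)) \<noteq> {\<zero>\<^bsub>dirac_cohomology V (act D)\<^esub>}))
   \<and> (\<forall>(k::complex) (U::(complex, 'u) module) gr actU act.
        (let N = 2 * (of_nat n - 1) * k\<^sup>2;
             D = elt_B n (k_ext n k) N (dirac n (pos_roots_D n) (\<lambda>_. k)); V = tensor U U in
         steinberg_D n k N U gr actU act \<longrightarrow>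
           D \<in> carrier (H_D n k N) \<and>
           (\<forall>v\<in>carrier V. act D v = \<zero>\<^bsub>V\<^esub>) \<and>
           carrier (dirac_cohomology V (act D)) \<noteq> {\<zero>\<^bsub>dirac_cohomology V (act D)\<^esub>}))"
  unfolding Let_def
  by (rule conjI[OF _ conjI]; intro allI impI;
      rule steinberg_A_conclusion[unfolded Let_def] steinberg_B_conclusion[OF assms, unfolded Let_def]
        steinberg_D_conclusion[OF assms, unfolded Let_def]; assumption)

end
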